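(* Let $r\in\mathbb{N}\cup\{0\}$, let $(K,\rho)$ be a nonempty compact metric space which is a $C^r$-smooth manifold if $r>0$, and let $X$ be the set of all $C^r$-diffeomorphisms of $K$ (homeomorphisms if $r=0$). Let $T\in X$ be a continuity point of the map $\mathcal{M}:S\mapsto\mathcal{M}(K,S)$ from $X$ to $Z$, and let $\varphi\in C^0(K\to\mathbb{R})$. Then for any $\varepsilon,\sigma>0$ there exists $\delta>0$ such that for any $p\in K$ and any $S\in X$ with $$d_{C^0}(S,T)<\delta,\qquad d_{C^0}(S^{-1},T^{-1})<\delta$$ there exist points $q_+,q_-\in K$ such that, for each of $q=q_+$ and $q=q_-$, $$\liminf_{n\to\infty}\frac{\#\{k=-n,\ldots,n: S^k(q)\in U_\sigma(\overline{O_T(p)})\}}{2n+1}\ge 1-\varepsilon,$$ and the following limits exist and satisfy $$\lim_{n\to\infty}\frac1{2n+1}\sum_{k=-n}^n\varphi(S^k(q_-))\ge\varphi_p^--\varepsilon,\qquad \lim_{n\to\infty}\frac1{2n+1}\sum_{k=-n}^n\varphi(S^k(q_+))\le\varphi_p^++\varepsilon,$$ where $$\varphi_p^-=\liminf_{n\to\infty}\frac1{2n+1}\sum_{k=-n}^n\varphi(T^k(p)),\qquad \varphi_p^+=\limsup_{n\to\infty}\frac1{2n+1}\sum_{k=-n}^n\varphi(T^k(p)).$$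
   Context: $d_{C^0}(S,T)=\sup_{x\in K}\rho(S(x),T(x))$; $X$ is considered with the topology of the $C^0$-closeness of maps and of their inverses, i.e. of the metric $d_{C^0}(S,T)+d_{C^0}(S^{-1},T^{-1})$. $O_T(p)=\{T^k(p):k\in\mathbb{Z}\}$ is the orbit of $p$, the bar denotes closure, and $U_\sigma(A)$ is the open $\sigma$-neighbourhood of a compact set $A$. $\mathcal{M}(K)$ is the set of Borel probability measures on $K$ with the Kantorovich–Rubinstein distance $W_1(\mu,\nu)=\sup\left(\int_K f\,d\mu-\int_K f\,d\nu\right)$ (supremum over $1$-Lipschitz $f:K\to\mathbb{R}$), which metrizes the weak-$*$ topology. $\mathcal{M}(K,S)\subset\mathcal{M}(K)$ is the nonempty compact set of $S$-invariant Borel probability measures. $Z$ is the set of nonempty compact subsets of $\mathcal{M}(K)$ with the Hausdorff metric $d_H(P,Q)=\max_{p\in P}W_1(p,Q)+\max_{q\in Q}W_1(q,P)$, where $W_1(p,Q)$ is the distance from the point $p$ to the set $Q$. *)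

theory Defs
  imports "HOL-Probability.Probability"
begin

text \<open>
  The compact metric space is the whole of a type of class \<open>metric_space\<close>; its compactness is a
  hypothesis of the theorem, and it is nonempty because types are.
\<close>

section \<open>Manifolds and diffeomorphisms of finite smoothness\<close>

text \<open>
  The model space of dimension \<open>d\<close> is \<^term>\<open>Euclidean_space d\<close>, whose points are the sequences
  \<open>x :: nat \<Rightarrow> real\<close> with \<open>x i = 0\<close> for \<open>i \<ge> d\<close>; this makes \<open>d\<close> an ordinary natural number,
  possibly zero.  For \<open>W\<close> open in the model space, \<open>Ck_on d k W f\<close> says that all partial
  derivatives of \<open>f\<close> of order at most \<open>k\<close> exist and are continuous on \<open>W\<close>.
\<close>

primrec Ck_on :: "nat \<Rightarrow> nat \<Rightarrow> (nat \<Rightarrow> real) set \<Rightarrow> ((nat \<Rightarrow> real) \<Rightarrow> real) \<Rightarrow> bool" where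
  "Ck_on d 0 W f \<longleftrightarrow> continuous_map (subtopology (Euclidean_space d) W) euclideanreal f"
| "Ck_on d (Suc k) W f \<longleftrightarrow>
     continuous_map (subtopology (Euclidean_space d) W) euclideanreal f \<and>
     (\<exists>g. \<forall>i<d. (\<forall>x\<in>W. ((\<lambda>t. f (x(i := t))) has_real_derivative g i x) (at (x i))) \<and>
                Ck_on d k W (g i))"

definition Ck_vec_on ::
    "nat \<Rightarrow> nat \<Rightarrow> (nat \<Rightarrow> real) set \<Rightarrow> ((nat \<Rightarrow> real) \<Rightarrow> (nat \<Rightarrow> real)) \<Rightarrow> bool" where
  "Ck_vec_on d k W F \<longleftrightarrow> (\<forall>i<d. Ck_on d k W (\<lambda>x. F x i))"

text \<open>
  A chart is a pair of an open domain and a map that matters on that domain only.  The Hausdorff and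
  second countability axioms are automatic for compact metric spaces.
\<close>

type_synonym 'a chart = "'a set \<times> ('a \<Rightarrow> nat \<Rightarrow> real)"

definition is_chart :: "nat \<Rightarrow> 'a::metric_space chart \<Rightarrow> bool" where
  "is_chart d c \<longleftrightarrow> (case c of (U, h) \<Rightarrow>
     open U \<and> openin (Euclidean_space d) (h ` U) \<and>
     homeomorphic_map (top_of_set U) (subtopology (Euclidean_space d) (h ` U)) h)"

definition Cr_atlas :: "nat \<Rightarrow> nat \<Rightarrow> 'a::metric_space chart set \<Rightarrow> bool" where
  "Cr_atlas r d A \<longleftrightarrow>
     (\<forall>c\<in>A. is_chart d c) \<and> (\<Union>(U, h)\<in>A. U) = UNIV \<and>
     (\<forall>(U, h)\<in>A. \<forall>(V, g)\<in>A. Ck_vec_on d r (h ` (U \<inter> V)) (g \<circ> inv_into U h))"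

definition Cr_map :: "nat \<Rightarrow> nat \<Rightarrow> 'a::metric_space chart set \<Rightarrow> ('a \<Rightarrow> 'a) \<Rightarrow> bool" where
  "Cr_map r d A f \<longleftrightarrow>
     continuous_on UNIV f \<and>
     (\<forall>(U, h)\<in>A. \<forall>(V, g)\<in>A. Ck_vec_on d r (h ` (U \<inter> f -` V)) (g \<circ> f \<circ> inv_into U h))"

text \<open>For \<open>r = 0\<close> the space carries no smooth structure, and \<open>d\<close> and \<open>A\<close> are ignored.\<close>

definition diffeos :: "nat \<Rightarrow> nat \<Rightarrow> 'a::metric_space chart set \<Rightarrow> ('a \<Rightarrow> 'a) set" where
  "diffeos r d A =
     (if r = 0 then {f. bij f \<and> continuous_on UNIV f \<and> continuous_on UNIV (inv f)}
      else {f. bij f \<and> Cr_map r d A f \<and> Cr_map r d A (inv f)})"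

section \<open>Uniform distances\<close>

definition dC0 :: "('a \<Rightarrow> 'a::metric_space) \<Rightarrow> ('a \<Rightarrow> 'a) \<Rightarrow> real" where
  "dC0 S T = (SUP x. dist (S x) (T x))"

definition dX :: "('a \<Rightarrow> 'a::metric_space) \<Rightarrow> ('a \<Rightarrow> 'a) \<Rightarrow> real" where
  "dX S T = dC0 S T + dC0 (inv S) (inv T)"

section \<open>Invariant measures\<close>

definition borel_probs :: "'a::metric_space measure set" where
  "borel_probs = {\<mu>. prob_space \<mu> \<and> sets \<mu> = sets borel}"

definition W1 :: "'a::metric_space measure \<Rightarrow> 'a measure \<Rightarrow> real" where
  "W1 \<mu> \<nu> = (SUP f \<in> {f :: 'a \<Rightarrow> real. 1-lipschitz_on UNIV f}. (\<integral>x. f x \<partial>\<mu>) - (\<integral>x. f x \<partial>\<nu>))"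

definition invariant_probs :: "('a \<Rightarrow> 'a::metric_space) \<Rightarrow> 'a measure set" where
  "invariant_probs S = {\<mu> \<in> borel_probs. distr \<mu> borel S = \<mu>}"

text \<open>The suprema and infima are attained for nonempty \<open>W1\<close>-compact sets.\<close>

definition dH :: "'a::metric_space measure set \<Rightarrow> 'a measure set \<Rightarrow> real" where
  "dH P Q = (SUP \<mu>\<in>P. INF \<nu>\<in>Q. W1 \<mu> \<nu>) + (SUP \<nu>\<in>Q. INF \<mu>\<in>P. W1 \<nu> \<mu>)"

definition continuity_point :: "('a \<Rightarrow> 'a::metric_space) set \<Rightarrow> ('a \<Rightarrow> 'a) \<Rightarrow> bool" where
  "continuity_point X T \<longleftrightarrow>
     T \<in> X \<and>
     (\<forall>e>0. \<exists>\<delta>>0. \<forall>S\<in>X. dX S T < \<delta> \<longrightarrow> dH (invariant_probs S) (invariant_probs T) < e)"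

section \<open>Two-sided orbits and averages\<close>

definition ziter :: "('a \<Rightarrow> 'a) \<Rightarrow> int \<Rightarrow> 'a \<Rightarrow> 'a" where
  "ziter T k = (if k \<ge> 0 then T ^^ nat k else inv T ^^ nat (- k))"

definition orbit :: "('a \<Rightarrow> 'a) \<Rightarrow> 'a \<Rightarrow> 'a set" where
  "orbit T p = range (\<lambda>k. ziter T k p)"

definition nhd :: "real \<Rightarrow> 'a::metric_space set \<Rightarrow> 'a set" where
  "nhd \<sigma> A = (\<Union>a\<in>A. ball a \<sigma>)"

definition avg :: "('a \<Rightarrow> real) \<Rightarrow> ('a \<Rightarrow> 'a) \<Rightarrow> 'a \<Rightarrow> nat \<Rightarrow> real" where
  "avg \<phi> S q n = (\<Sum>k = - int n..int n. \<phi> (ziter S k q)) / (2 * real n + 1)"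

definition visit_freq :: "'a set \<Rightarrow> ('a \<Rightarrow> 'a) \<Rightarrow> 'a \<Rightarrow> nat \<Rightarrow> real" where
  "visit_freq B S q n = real (card {k \<in> {- int n..int n}. ziter S k q \<in> B}) / (2 * real n + 1)"

end

theory Submission
  imports Defs "HOL-Real_Asymp.Real_Asymp"
begin

text \<open>
  A limit point of the empirical measures of the two-sided orbit of \<open>p\<close> under \<open>T\<close> is a
  \<open>T\<close>-invariant probability measure \<open>\<mu>\<close>, carried by the orbit closure \<open>F\<close>, with \<open>\<integral>\<phi> d\<mu>\<close> between the
  lower and the upper orbit average of \<open>\<phi>\<close> (\<open>krylov_bogolyubov\<close>).  Continuity of the set of
  invariant measures at \<open>T\<close> provides, for every \<open>S\<close> near \<open>T\<close>, an \<open>S\<close>-invariant \<open>\<nu>\<close> that is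
  \<open>W1\<close>-close to \<open>\<mu>\<close> (\<open>dH_less_obtain\<close>), with a bound that depends neither on \<open>p\<close> nor on \<open>S\<close>.
  Hence \<open>\<integral>\<phi> d\<nu>\<close> is close to \<open>\<integral>\<phi> d\<mu>\<close>, and \<open>\<integral>f d\<nu>\<close> is close to \<open>1\<close>, where
  \<open>f = bump (1 / \<sigma>) F\<close> is a Lipschitz function that equals \<open>1\<close> on \<open>F\<close>, vanishes off
  the \<open>\<sigma>\<close>-neighbourhood of \<open>F\<close> and is at most \<open>1\<close>.

  The measure \<open>\<nu>\<close> need not be ergodic, so a \<open>\<nu>\<close>-typical point may have averages far from the
  integrals.  But the limits \<open>a\<close> and \<open>b\<close> of the orbit averages of \<open>\<phi>\<close> and \<open>f\<close> exist at almost every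
  point, and \<open>a + C * b\<close> has mean \<open>\<integral>\<phi> d\<nu> + C * \<integral>f d\<nu>\<close>, so some point reaches at least this value
  (\<open>exists_point_above_mean\<close>).  As \<open>b \<le> 1\<close> and \<open>a \<le> sup |\<phi>|\<close>, for a large weight \<open>C\<close> and
  \<open>\<integral>f d\<nu>\<close> close enough to \<open>1\<close> this single inequality bounds \<open>a\<close> below by nearly \<open>\<integral>\<phi> d\<nu>\<close> and \<open>b\<close> below by
  nearly \<open>1\<close> (\<open>exists_point_near_set_above_mean\<close>).  This yields the point \<open>qm\<close>; the same argument for
  \<open>- \<phi>\<close> yields \<open>qp\<close>.

  Three classical results are proved for this purpose: the Riesz representation
  theorem for compact metric spaces by Daniell's outer measure (\<open>integral_riesz\<close>), from which the
  Krylov-Bogolyubov theorem follows, and Birkhoff's almost everywhere convergence of averages by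
  the maximal ergodic inequality (\<open>birkhoff_convergent\<close>).
\<close>

section \<open>Continuous approximations of the indicator of a closed set\<close>

definition bump :: "real \<Rightarrow> 'a::metric_space set \<Rightarrow> 'a \<Rightarrow> real" where
  "bump c F x = max 0 (1 - c * infdist x F)"

lemma continuous_on_bump [continuous_intros]: "continuous_on S (bump c F)"
  unfolding bump_def by (intro continuous_intros)

lemma bump_nonneg: "0 \<le> bump c F x"
  by (simp add: bump_def)

lemma bump_le_1: "0 \<le> c \<Longrightarrow> bump c F x \<le> 1"
  by (simp add: bump_def infdist_nonneg)

lemma bump_eq_1: "x \<in> F \<Longrightarrow> bump c F x = 1"
  by (simp add: bump_def)

lemma bump_antimono: "c \<le> c' \<Longrightarrow> bump c' F x \<le> bump c F x"
  unfolding bump_def by (intro max.mono diff_left_mono mult_right_mono infdist_nonneg) simp_all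

lemma tendsto_bump:
  assumes "closed F" "F \<noteq> {}"
  shows "(\<lambda>k. bump (real k) F x) \<longlonglongrightarrow> indicator F x"
proof (cases "x \<in> F")
  case False
  then have "infdist x F > 0"
    using in_closed_iff_infdist_zero[OF assms, of x] infdist_nonneg[of x F] by force
  then obtain K :: nat where K: "1 \<le> real K * infdist x F"
    by (metis less_imp_le reals_Archimedean3)
  have "bump (real k) F x = 0" if "k \<ge> K" for k
  proof -
    have "real K * infdist x F \<le> real k * infdist x F"
      using that by (intro mult_right_mono infdist_nonneg) simp
    then show ?thesis using K by (simp add: bump_def)
  qed
  then show ?thesis
    using False by (intro tendsto_eventually) (auto simp: eventually_sequentially)
qed (simp add: bump_eq_1)

section \<open>The Riesz representation theorem on a compact metric space\<close>

locale normalized_positive_functional =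
  fixes \<Lambda> :: "('a::metric_space \<Rightarrow> real) \<Rightarrow> real"
  assumes compact_UNIV: "compact (UNIV :: 'a set)"
    and add: "\<And>f g. continuous_on UNIV f \<Longrightarrow> continuous_on UNIV g \<Longrightarrow> \<Lambda> (\<lambda>x. f x + g x) = \<Lambda> f + \<Lambda> g"
    and scale: "\<And>c f. continuous_on UNIV f \<Longrightarrow> \<Lambda> (\<lambda>x. c * f x) = c * \<Lambda> f"
    and nonneg: "\<And>f. continuous_on UNIV f \<Longrightarrow> (\<And>x. 0 \<le> f x) \<Longrightarrow> 0 \<le> \<Lambda> f"
    and one: "\<Lambda> (\<lambda>_. 1) = 1"
begin

lemma const: "\<Lambda> (\<lambda>_. c) = c"
  using scale[of "\<lambda>_. 1" c] one by simp

lemma diff: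
  assumes "continuous_on UNIV f" "continuous_on UNIV g"
  shows "\<Lambda> (\<lambda>x. f x - g x) = \<Lambda> f - \<Lambda> g"
proof -
  have "\<Lambda> (\<lambda>x. f x + (-1) * g x) = \<Lambda> f + \<Lambda> (\<lambda>x. (-1) * g x)"
    using assms by (intro add continuous_intros)
  also have "\<Lambda> (\<lambda>x. (-1) * g x) = - \<Lambda> g"
    using scale[OF assms(2), of "-1"] by simp
  finally show ?thesis by simp
qed

lemma mono:
  assumes "continuous_on UNIV f" "continuous_on UNIV g" "\<And>x. f x \<le> g x"
  shows "\<Lambda> f \<le> \<Lambda> g"
proof -
  have "0 \<le> \<Lambda> (\<lambda>x. g x - f x)"
    using assms by (intro nonneg continuous_intros) auto
  then show ?thesis using diff[OF assms(2,1)] by simp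
qed

lemma sum:
  assumes "finite I" "\<And>i. i \<in> I \<Longrightarrow> continuous_on UNIV (f i)"
  shows "\<Lambda> (\<lambda>x. \<Sum>i\<in>I. f i x) = (\<Sum>i\<in>I. \<Lambda> (f i))"
  using assms
proof (induction I)
  case empty
  show ?case using const[of 0] by simp
next
  case (insert i I)
  then have "\<Lambda> (\<lambda>x. f i x + (\<Sum>i\<in>I. f i x)) = \<Lambda> (f i) + \<Lambda> (\<lambda>x. \<Sum>i\<in>I. f i x)"
    by (intro add continuous_intros) auto
  then show ?case using insert by simp
qed

text \<open>
  Daniell's outer measure: a set is covered by series of nonnegative continuous functions instead of
  by open sets, and the cost of a cover is the sum of the values of the functional.
\<close>
definition covers :: "'a set \<Rightarrow> (nat \<Rightarrow> 'a \<Rightarrow> real) set" where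
  "covers A = {f. (\<forall>n. continuous_on UNIV (f n)) \<and> (\<forall>n x. 0 \<le> f n x) \<and>
     (\<forall>x\<in>A. 1 \<le> (\<Sum>n. ennreal (f n x)))}"

definition outer :: "'a set \<Rightarrow> ennreal" where
  "outer A = (INF f\<in>covers A. \<Sum>n. ennreal (\<Lambda> (f n)))"

lemma coversD:
  assumes "f \<in> covers A"
  shows "continuous_on UNIV (f n)" "0 \<le> f n x" "x \<in> A \<Longrightarrow> 1 \<le> (\<Sum>n. ennreal (f n x))"
  using assms by (auto simp: covers_def)

lemma outer_le: "f \<in> covers A \<Longrightarrow> outer A \<le> (\<Sum>n. ennreal (\<Lambda> (f n)))"
  unfolding outer_def by (rule INF_lower)

lemma outer_le_single:
  assumes "continuous_on UNIV g" "\<And>x. 0 \<le> g x" "\<And>x. x \<in> A \<Longrightarrow> 1 \<le> g x"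
  shows "outer A \<le> ennreal (\<Lambda> g)"
proof -
  let ?f = "\<lambda>n::nat. if n = 0 then g else (\<lambda>_. 0)"
  have *: "(\<Sum>n. ennreal (?f n x)) = ennreal (g x)" for x
    by (subst suminf_finite[of "{0}"]) auto
  have "?f \<in> covers A"
    unfolding covers_def using assms * by (auto simp: ennreal_leI)
  then have "outer A \<le> (\<Sum>n. ennreal (\<Lambda> (?f n)))"
    by (rule outer_le)
  also have "\<dots> = ennreal (\<Lambda> g)"
    using const[of 0] by (subst suminf_finite[of "{0}"]) auto
  finally show ?thesis .
qed

lemma outer_mono: "A \<subseteq> B \<Longrightarrow> outer A \<le> outer B"
  unfolding outer_def by (rule INF_superset_mono) (auto simp: covers_def)

lemma outer_UN: "outer (\<Union>i. A i) \<le> (\<Sum>i. outer (A i))"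
proof (rule ennreal_le_epsilon)
  fix e :: real assume e: "0 < e" "(\<Sum>i. outer (A i)) < top"
  then have "outer (A n) < outer (A n) + e * (1/2)^Suc n" for n
    by (auto simp add: less_top dest!: ennreal_suminf_lessD)
  then have "\<exists>f\<in>covers (A n). (\<Sum>k. ennreal (\<Lambda> (f k))) < outer (A n) + e * (1/2)^Suc n" for n
    by (subst (asm) outer_def) (auto simp: INF_less_iff)
  then obtain F where F: "\<And>n. F n \<in> covers (A n)"
    "\<And>n. (\<Sum>k. ennreal (\<Lambda> (F n k))) \<le> outer (A n) + e * (1/2)^Suc n"
    by (metis less_imp_le)
  define G where "G i = case_prod F (prod_decode i)" for i
  have two_sum: "(\<Sum>i. h (G i)) = (\<Sum>n. \<Sum>k. h (F n k))" for h :: "_ \<Rightarrow> ennreal"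
    using suminf_ennreal_2dimen[of "\<lambda>n. \<Sum>k. h (F n k)" "\<lambda>(n,k). h (F n k)"]
    by (simp add: G_def split_def)
  have "1 \<le> (\<Sum>i. ennreal (G i x))" if "x \<in> A n" for x n
  proof -
    have "1 \<le> (\<Sum>k. ennreal (F n k x))" using coversD(3)[OF F(1)] that by blast
    also have "\<dots> \<le> (\<Sum>n. \<Sum>k. ennreal (F n k x))"
      using sum_le_suminf[of "\<lambda>n. \<Sum>k. ennreal (F n k x)" "{n}"] by simp
    finally show ?thesis using two_sum[of "\<lambda>f. ennreal (f x)"] by simp
  qed
  then have "G \<in> covers (\<Union>i. A i)"
    using coversD(1,2)[OF F(1)] by (auto simp: covers_def G_def split_def)
  then have "outer (\<Union>i. A i) \<le> (\<Sum>i. ennreal (\<Lambda> (G i)))"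
    by (rule outer_le)
  also have "\<dots> = (\<Sum>n. \<Sum>k. ennreal (\<Lambda> (F n k)))"
    by (rule two_sum)
  also have "\<dots> \<le> (\<Sum>n. outer (A n) + e * (1/2)^Suc n)"
    by (intro suminf_le F(2)) auto
  also have "... = (\<Sum>n. outer (A n)) + (\<Sum>n. ennreal e * ennreal ((1/2) ^ Suc n))"
    using \<open>0 < e\<close> by (subst suminf_add[symmetric])
      (auto simp del: ennreal_suminf_cmult simp add: ennreal_mult[symmetric])
  also have "\<dots> = (\<Sum>n. outer (A n)) + e"
    unfolding ennreal_suminf_cmult
    by (subst suminf_ennreal_eq[OF zero_le_power power_half_series]) auto
  finally show "outer (\<Union>i. A i) \<le> (\<Sum>n. outer (A n)) + ennreal e" .
qed

lemma outer_empty: "outer {} = 0"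
  using outer_le_single[of "\<lambda>_. 0" "{}"] const[of 0] by simp

lemma outer_measure_space_outer: "outer_measure_space (Pow UNIV) outer"
  unfolding outer_measure_space_def positive_def increasing_def countably_subadditive_def
  using outer_empty outer_mono outer_UN by auto

text \<open>
  A cover \<open>f\<close> of \<open>A\<close> splits into covers of \<open>A \<inter> F\<close> and \<open>A - F\<close>.  With continuous \<open>h 0 = 1\<close> and
  \<open>h k\<close> decreasing to the indicator of \<open>F\<close>, the functions \<open>f n * h (N n)\<close> cover \<open>A \<inter> F\<close> for any choice
  of \<open>N\<close>, and the differences \<open>f n * (h k - h (Suc k))\<close> cover \<open>A - F\<close> because they telescope
  to \<open>f n\<close> there.  Applying the functional to the differences telescopes too, so if \<open>N n\<close> is
  large both covers together cost hardly more than \<open>f\<close>.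
\<close>
lemma outer_split_closed:
  assumes "closed F"
  shows "outer (A \<inter> F) + outer (A - F) \<le> outer A"
proof (cases "F = {}")
  case False
  define h where "h k = bump (real k) F" for k
  have h_cont: "continuous_on UNIV (h k)" for k
    unfolding h_def by (rule continuous_on_bump)
  have h_0: "h 0 x = 1" for x by (simp add: h_def bump_def)
  have h_nonneg: "0 \<le> h k x" for k x by (simp add: h_def bump_nonneg)
  have h_F: "h k x = 1" if "x \<in> F" for k x using that by (simp add: h_def bump_eq_1)
  have h_Suc: "h (Suc k) x \<le> h k x" for k x
    unfolding h_def by (intro bump_antimono) simp
  have h_lim: "(\<lambda>k. h k x) \<longlonglongrightarrow> 0" if "x \<notin> F" for x
    using tendsto_bump[OF assms False, of x] that by (simp add: h_def)
  have "outer (A \<inter> F) + outer (A - F) \<le> (\<Sum>n. ennreal (\<Lambda> (f n)))" if f: "f \<in> covers A" for f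
  proof (rule ennreal_le_epsilon)
    fix e :: real assume e: "0 < e"
    note [continuous_intros] = coversD(1)[OF f] h_cont
    define c where "c n k = \<Lambda> (\<lambda>x. f n x * h k x)" for n k
    have c_nonneg: "0 \<le> c n k" for n k
      unfolding c_def using coversD(2)[OF f] h_nonneg by (intro nonneg continuous_intros) auto
    have c_Suc: "c n (Suc k) \<le> c n k" for n k
      unfolding c_def using coversD(2)[OF f] h_Suc
      by (intro mono continuous_intros mult_left_mono) auto
    have c_0: "c n 0 = \<Lambda> (f n)" for n by (simp add: c_def h_0)
    have "\<exists>l. c n \<longlonglongrightarrow> l" for n
      using c_Suc[of n] c_nonneg[of n] decseq_convergent[of "c n" 0] by (metis decseq_SucI)
    then obtain l where l: "\<And>n. c n \<longlonglongrightarrow> l n" by metis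
    have l_le: "l n \<le> c n k" for n k
      using c_Suc by (intro decseq_ge[OF _ l] decseq_SucI)
    have "\<exists>N. c n N < l n + e * (1/2)^Suc n" for n
      using order_tendstoD(2)[OF l[of n], of "l n + e * (1/2)^Suc n"] e
      by (auto simp: eventually_sequentially)
    then obtain N where N: "\<And>n. c n (N n) < l n + e * (1/2)^Suc n" by metis

    have 1: "(\<lambda>n x. f n x * h (N n) x) \<in> covers (A \<inter> F)"
      using coversD[OF f] h_nonneg h_F
      by (auto simp: covers_def intro!: continuous_intros)
    define g where "g n k x = f n x * (h k x - h (Suc k) x)" for n k x
    define G where "G i = case_prod g (prod_decode i)" for i
    have g_nonneg: "0 \<le> g n k x" for n k x
      unfolding g_def using coversD(2)[OF f] h_Suc by simp
    have two_sum: "(\<Sum>i. u (G i)) = (\<Sum>n. \<Sum>k. u (g n k))" for u :: "_ \<Rightarrow> ennreal"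
      using suminf_ennreal_2dimen[of "\<lambda>n. \<Sum>k. u (g n k)" "\<lambda>(n,k). u (g n k)"]
      by (simp add: G_def split_def)
    have "(\<Sum>k. ennreal (g n k x)) = ennreal (f n x)" if "x \<notin> F" for n x
    proof (rule suminf_ennreal_eq[OF g_nonneg])
      have "(\<lambda>k. h k x - h (Suc k) x) sums (h 0 x - 0)"
        by (intro telescope_sums' h_lim that)
      from sums_mult[OF this, of "f n x"] show "(\<lambda>k. g n k x) sums f n x"
        by (simp add: g_def h_0)
    qed
    then have "(\<Sum>i. ennreal (G i x)) = (\<Sum>n. ennreal (f n x))" if "x \<notin> F" for x
      using that two_sum[of "\<lambda>f. ennreal (f x)"] by simp
    moreover have "continuous_on UNIV (G i)" "0 \<le> G i x" for i x
      using g_nonneg by (auto simp: G_def g_def split_def intro!: continuous_intros)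
    ultimately have 2: "G \<in> covers (A - F)"
      using coversD(3)[OF f] by (auto simp: covers_def)
    have "\<Lambda> (g n k) = c n k - c n (Suc k)" for n k
      unfolding g_def c_def right_diff_distrib by (intro diff continuous_intros)
    then have "(\<Sum>k. ennreal (\<Lambda> (g n k))) = ennreal (\<Lambda> (f n) - l n)" for n
      using telescope_sums'[OF l[of n]] c_Suc by (intro suminf_ennreal_eq) (auto simp: c_0)
    then have sum_G: "(\<Sum>i. ennreal (\<Lambda> (G i))) = (\<Sum>n. ennreal (\<Lambda> (f n) - l n))"
      using two_sum[of "\<lambda>f. ennreal (\<Lambda> f)"] by simp
    have "outer (A \<inter> F) + outer (A - F) \<le> (\<Sum>n. ennreal (c n (N n))) + (\<Sum>n. ennreal (\<Lambda> (f n) - l n))"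
      using outer_le[OF 1] outer_le[OF 2] unfolding sum_G c_def by (rule add_mono)
    also have "\<dots> = (\<Sum>n. ennreal (c n (N n)) + ennreal (\<Lambda> (f n) - l n))"
      by (intro suminf_add) auto
    also have "\<dots> \<le> (\<Sum>n. ennreal (\<Lambda> (f n)) + ennreal e * ennreal ((1/2)^Suc n))"
    proof (intro suminf_le)
      fix n
      have "l n \<le> \<Lambda> (f n)" using l_le[of n 0] c_0 by simp
      moreover have "0 \<le> \<Lambda> (f n)" using c_nonneg[of n 0] c_0 by simp
      ultimately show "ennreal (c n (N n)) + ennreal (\<Lambda> (f n) - l n)
          \<le> ennreal (\<Lambda> (f n)) + ennreal e * ennreal ((1/2)^Suc n)"
        using N[of n] c_nonneg[of n "N n"] e
        by (simp add: ennreal_mult[symmetric] ennreal_plus[symmetric] del: ennreal_plus)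
    qed auto
    also have "\<dots> = (\<Sum>n. ennreal (\<Lambda> (f n))) + (\<Sum>n. ennreal e * ennreal ((1/2)^Suc n))"
      by (intro suminf_add[symmetric]) auto
    also have "\<dots> = (\<Sum>n. ennreal (\<Lambda> (f n))) + ennreal e"
      unfolding ennreal_suminf_cmult
      by (subst suminf_ennreal_eq[OF zero_le_power power_half_series]) auto
    finally show "outer (A \<inter> F) + outer (A - F) \<le> (\<Sum>n. ennreal (\<Lambda> (f n))) + ennreal e" .
  qed
  then show ?thesis unfolding outer_def[of A] by (intro INF_greatest)
qed (simp add: outer_empty)

text \<open>
  The lower bound is where compactness enters: finitely many terms of a cover of the whole space
  already exceed \<open>1 - e\<close> everywhere.
\<close>
lemma outer_UNIV: "outer UNIV = 1"
proof (rule antisym)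
  show "outer UNIV \<le> 1" using outer_le_single[of "\<lambda>_. 1" UNIV] one by simp
  show "1 \<le> outer UNIV"
    unfolding outer_def
  proof (intro INF_greatest)
    fix f assume f: "f \<in> covers UNIV"
    note [continuous_intros] = coversD(1)[OF f]
    show "1 \<le> (\<Sum>n. ennreal (\<Lambda> (f n)))"
    proof (rule ennreal_le_epsilon)
      fix e :: real assume e: "0 < e"
      define U where "U N = {x. 1 - e < (\<Sum>n<N. f n x)}" for N :: nat
      have "open (U N)" for N
        unfolding U_def by (intro open_Collect_less continuous_intros)
      moreover have "\<exists>N. x \<in> U N" for x
      proof -
        have "ennreal (1 - e) < 1" using e by simp
        also note coversD(3)[OF f UNIV_I[of x]]
        finally have "ennreal (1 - e) < (SUP N. \<Sum>n<N. ennreal (f n x))"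
          by (simp only: suminf_eq_SUP)
        then obtain N where "ennreal (1 - e) < (\<Sum>n<N. ennreal (f n x))"
          by (auto simp: less_SUP_iff)
        then show ?thesis
          using coversD(2)[OF f] ennreal_leI[of "\<Sum>n<N. f n x" "1 - e"]
          by (intro exI[of _ N]) (auto simp: U_def not_less[symmetric])
      qed
      ultimately obtain C where C: "finite C" "UNIV \<subseteq> (\<Union>N\<in>C. U N)"
        using compactE_image[OF compact_UNIV, of UNIV U] by (metis UNIV_I UN_I subsetI)
      define N where "N = Max (insert 0 C)"
      have "1 - e \<le> (\<Sum>n<N. f n x)" for x
      proof -
        obtain M where "M \<in> C" "x \<in> U M" using C(2) by blast
        moreover have "(\<Sum>n<M. f n x) \<le> (\<Sum>n<N. f n x)"
          using \<open>M \<in> C\<close> C(1) coversD(2)[OF f] by (intro sum_mono2) (auto simp: N_def)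
        ultimately show ?thesis by (simp add: U_def)
      qed
      then have "\<Lambda> (\<lambda>_. 1 - e) \<le> \<Lambda> (\<lambda>x. \<Sum>n<N. f n x)"
        by (intro mono continuous_intros) auto
      also have "\<dots> = (\<Sum>n<N. \<Lambda> (f n))"
        by (intro sum continuous_intros) auto
      finally have "1 \<le> (\<Sum>n<N. \<Lambda> (f n)) + e" by (simp add: const)
      moreover have pos: "0 \<le> \<Lambda> (f n)" for n
        using coversD(2)[OF f] by (intro nonneg continuous_intros) auto
      ultimately have "1 \<le> (\<Sum>n<N. ennreal (\<Lambda> (f n))) + ennreal e"
        using e by (simp add: sum_nonneg flip: ennreal_plus)
      also have "\<dots> \<le> (\<Sum>n. ennreal (\<Lambda> (f n))) + ennreal e"
        by (intro add_right_mono sum_le_suminf) auto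
      finally show "1 \<le> (\<Sum>n. ennreal (\<Lambda> (f n))) + ennreal e" .
    qed
  qed
qed

definition riesz :: "'a measure" where
  "riesz = measure_of UNIV (sets borel) outer"

lemma sets_riesz: "sets riesz = sets borel"
  unfolding riesz_def by (metis sets.sets_measure_of_eq space_borel)

lemma emeasure_riesz:
  assumes "A \<in> sets borel"
  shows "emeasure riesz A = outer A"
proof -
  interpret P: sigma_algebra UNIV "Pow (UNIV :: 'a set)" by (rule sigma_algebra_Pow)
  let ?L = "lambda_system UNIV (Pow UNIV) outer"
  have ms: "measure_space UNIV ?L outer"
    by (rule P.caratheodory_lemma[OF outer_measure_space_outer])
  have "F \<in> ?L" if "closed F" for F
  proof -
    have "outer x \<le> outer (x \<inter> F) + outer (x - F)" for x
    proof -
      have "outer x = outer (\<Union>i. binaryset (x \<inter> F) (x - F) i)"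
        by (simp only: UN_binaryset_eq) (simp add: Int_Diff_Un)
      also have "\<dots> \<le> (\<Sum>i. outer (binaryset (x \<inter> F) (x - F) i))"
        by (rule outer_UN)
      also have "\<dots> = outer (x \<inter> F) + outer (x - F)"
        by (rule suminf_binaryset_eq) (rule outer_empty)
      finally show ?thesis .
    qed
    then show ?thesis
      using outer_split_closed[OF that] by (subst P.lambda_system_eq) (auto intro!: antisym)
  qed
  moreover have "sigma_algebra UNIV ?L" using ms by (simp add: measure_space_def)
  ultimately have "sets borel \<subseteq> ?L"
    unfolding borel_eq_closed using sigma_algebra.sigma_sets_subset[of UNIV ?L "Collect closed"]
    by (auto simp: sets_measure_of)
  then have "measure_space UNIV (sets borel) outer"
    by (intro measure_down[OF ms]) (auto simp: sets.sigma_algebra_axioms[of borel, simplified])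
  then show ?thesis
    unfolding riesz_def using assms
    by (subst emeasure_measure_of_sigma) (auto simp: measure_space_def)
qed

lemma space_riesz: "space riesz = UNIV"
  unfolding riesz_def by simp

lemma prob_space_riesz: "prob_space riesz"
  by (intro prob_spaceI) (simp add: space_riesz emeasure_riesz outer_UNIV)

lemma integrable_riesz:
  fixes f :: "'a \<Rightarrow> real"
  assumes "continuous_on UNIV f"
  shows "integrable riesz f"
proof -
  interpret R: prob_space riesz by (rule prob_space_riesz)
  obtain B where "\<And>x. norm (f x) \<le> B"
    using compact_imp_bounded[OF compact_continuous_image[OF assms compact_UNIV]]
    by (auto simp: bounded_iff)
  then have "AE x in riesz. norm (f x) \<le> B" by simp
  then show ?thesis
    by (rule R.integrable_const_bound)
      (simp add: measurable_cong_sets[OF sets_riesz refl] borel_measurable_continuous_onI[OF assms])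
qed

text \<open>
  Layer cake: \<open>g\<close> is the sum of its slices \<open>s j\<close> between the heights \<open>j\<close> and \<open>j + 1\<close>, and the slice
  above is at most the indicator of the set \<open>E j\<close> where the slice \<open>s j\<close> is full.  The error \<open>1\<close> comes
  from the lowest slice; applying the lemma to multiples of \<open>g\<close> removes it.
\<close>
lemma integral_riesz_le_add_1:
  assumes g: "continuous_on UNIV g" "\<And>x. 0 \<le> g x"
  shows "(\<integral>x. g x \<partial>riesz) \<le> 1 + \<Lambda> g"
proof -
  interpret R: prob_space riesz by (rule prob_space_riesz)
  note [continuous_intros] = g(1)
  define s where "s j x = max 0 (min 1 (g x - real j))" for j x
  have s_cont [continuous_intros]: "continuous_on UNIV (s j)" for j
    unfolding s_def by (intro continuous_intros)
  obtain B where B: "\<And>x. g x \<le> B"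
    using compact_UNIV g(1) by (metis UNIV_I UNIV_not_empty continuous_attains_sup)
  obtain m where m: "B \<le> real (Suc m)"
    using real_arch_simple[of B] by (metis le_SucI nat_le_linear of_nat_le_iff order.trans order_refl)
  have sum_s: "(\<Sum>j<k. s j x) = min (g x) (real k)" for k x
    by (induction k) (use g(2)[of x] in \<open>auto simp: s_def\<close>)
  have g_eq: "g x = (\<Sum>j<Suc m. s j x)" for x
    using B[of x] m unfolding sum_s by simp
  define E where "E j = {x. 1 \<le> s j x}" for j
  have E: "E j \<in> sets riesz" for j
  proof -
    have "closed (E j)" unfolding E_def by (intro closed_Collect_le continuous_intros)
    then show ?thesis by (simp add: sets_riesz)
  qed
  have s_le: "s (Suc j) x \<le> indicator (E j) x" for j x
    by (auto simp: s_def E_def indicator_def)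
  have "g x \<le> 1 + (\<Sum>j<m. indicator (E j) x)" for x
  proof -
    have "g x = s 0 x + (\<Sum>j<m. s (Suc j) x)"
      by (subst g_eq, subst sum.lessThan_Suc_shift) simp
    also have "\<dots> \<le> 1 + (\<Sum>j<m. indicator (E j) x)"
      by (intro add_mono sum_mono s_le) (simp add: s_def)
    finally show ?thesis .
  qed
  moreover have "integrable riesz g" by (rule integrable_riesz[OF g(1)])
  moreover have int_E: "integrable riesz (\<lambda>x. indicator (E j) x :: real)" for j
    using E[of j] by (simp add: R.emeasure_eq_measure)
  ultimately have "(\<integral>x. g x \<partial>riesz) \<le> (\<integral>x. 1 + (\<Sum>j<m. indicator (E j) x) \<partial>riesz)"
    by (intro integral_mono) (auto intro!: Bochner_Integration.integrable_add Bochner_Integration.integrable_sum)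
  also have "\<dots> = 1 + (\<Sum>j<m. measure riesz (E j))"
    using int_E E by (simp add: Bochner_Integration.integral_add R.prob_space)
  also have "\<dots> \<le> 1 + (\<Sum>j<m. \<Lambda> (s j))"
  proof (intro add_left_mono sum_mono)
    fix j
    have "emeasure riesz (E j) \<le> ennreal (\<Lambda> (s j))"
      using E unfolding sets_riesz
      by (subst emeasure_riesz) (auto intro!: outer_le_single s_cont simp: E_def s_def)
    then show "measure riesz (E j) \<le> \<Lambda> (s j)"
      using nonneg[OF s_cont[of j]] by (simp add: R.emeasure_eq_measure s_def)
  qed
  also have "\<dots> = 1 + \<Lambda> (\<lambda>x. \<Sum>j<m. s j x)"
    by (subst sum) (auto intro: continuous_intros)
  also have "\<dots> \<le> 1 + \<Lambda> g"
    by (intro add_left_mono mono continuous_intros) (simp add: sum_s)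
  finally show ?thesis .
qed

lemma integral_riesz_le:
  assumes g: "continuous_on UNIV g" "\<And>x. 0 \<le> g x"
  shows "(\<integral>x. g x \<partial>riesz) \<le> \<Lambda> g"
proof (rule field_le_epsilon)
  fix e :: real assume "0 < e"
  then obtain n :: nat where n: "1 < real n * e" using reals_Archimedean3 by blast
  then have "0 < real n" by (cases n) auto
  have "real n * (\<integral>x. g x \<partial>riesz) \<le> 1 + real n * \<Lambda> g"
    using integral_riesz_le_add_1[of "\<lambda>x. real n * g x"] g scale[OF g(1), of "real n"]
    by (simp add: continuous_intros)
  also have "\<dots> \<le> real n * (\<Lambda> g + e)" using n by (simp add: algebra_simps)
  finally show "(\<integral>x. g x \<partial>riesz) \<le> \<Lambda> g + e" using \<open>0 < real n\<close> by simp
qed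

theorem integral_riesz:
  assumes f: "continuous_on UNIV f"
  shows "(\<integral>x. f x \<partial>riesz) = \<Lambda> f"
proof -
  interpret R: prob_space riesz by (rule prob_space_riesz)
  have le: "(\<integral>x. g x \<partial>riesz) \<le> \<Lambda> g" if g: "continuous_on UNIV g" for g
  proof -
    obtain B where B: "\<And>x. - B \<le> g x"
      using compact_UNIV g by (metis UNIV_I UNIV_not_empty continuous_attains_inf minus_minus)
    have "(\<integral>x. g x + B \<partial>riesz) \<le> \<Lambda> (\<lambda>x. g x + B)"
      by (intro integral_riesz_le continuous_intros g) (metis B add.commute add_le_cancel_left add.right_inverse)
    also have "\<dots> = \<Lambda> g + B" using g const[of B] by (simp add: add)
    finally show ?thesis using integrable_riesz[OF g] by (simp add: R.prob_space)
  qed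
  have "\<Lambda> (\<lambda>x. - f x) = - \<Lambda> f" using scale[OF f, of "-1"] by simp
  then show ?thesis using le[OF f] le[of "\<lambda>x. - f x"] f by (simp add: continuous_intros)
qed

end

section \<open>Invariant measures from orbit averages\<close>

text \<open>
  The evaluations \<open>u \<mapsto> u n\<close> lie in a product of compact intervals, one for each bounded sequence \<open>u\<close>,
  so by Tychonoff's theorem they have a cluster point.
\<close>
lemma exists_generalized_limit:
  obtains L :: "(nat \<Rightarrow> real) \<Rightarrow> real" where
    "\<And>u v. Bseq u \<Longrightarrow> Bseq v \<Longrightarrow> L (\<lambda>n. u n + v n) = L u + L v"
    "\<And>c u. Bseq u \<Longrightarrow> L (\<lambda>n. c * u n) = c * L u"
    "\<And>c u. Bseq u \<Longrightarrow> \<forall>\<^sub>F n in sequentially. c \<le> u n \<Longrightarrow> c \<le> L u"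
proof -
  \<comment> \<open>Unbounded sequences are sent to 0, so that every coordinate stays in a compact interval.\<close>
  define e :: "nat \<Rightarrow> (nat \<Rightarrow> real) \<Rightarrow> real" where "e n u = (if Bseq u then u n else 0)" for n u
  have "\<exists>C. \<forall>n. e n u \<in> cball 0 C" for u
    using less_imp_le by (cases "Bseq u") (force simp: e_def Bseq_def[of u], auto simp: e_def)
  then obtain C where C: "\<And>u n. e n u \<in> cball 0 (C u)" by metis
  define K where "K = PiE UNIV (\<lambda>u :: nat \<Rightarrow> real. cball (0::real) (C u))"
  have "compactin (product_topology (\<lambda>u. euclidean) UNIV) K"
    unfolding K_def by (subst compactin_PiE) simp
  then have "compact K" unfolding euclidean_product_topology by simp
  moreover have "\<forall>\<^sub>F l in filtermap e sequentially. l \<in> K"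
    using C by (auto simp: eventually_filtermap K_def PiE_UNIV_domain)
  ultimately obtain L where L: "inf (nhds L) (filtermap e sequentially) \<noteq> bot"
    unfolding compact_filter by (metis filtermap_bot_iff trivial_limit_sequentially)
  define F where "F = inf (nhds L) (filtermap e sequentially)"
  have F: "F \<noteq> bot" using L by (simp add: F_def)
  have lim: "((\<lambda>l. l u) \<longlongrightarrow> L u) F" for u
  proof (rule tendsto_mono)
    show "F \<le> nhds L" by (simp add: F_def)
    show "((\<lambda>l. l u) \<longlongrightarrow> L u) (nhds L)"
    proof (rule topological_tendstoI)
      fix U :: "real set" assume "open U" "L u \<in> U"
      then show "\<forall>\<^sub>F l in nhds L. l u \<in> U"
        using open_vimage[OF \<open>open U\<close> continuous_on_product_coordinates[of u]]
        by (auto simp: eventually_nhds intro!: exI[of _ "(\<lambda>l. l u) -` U"])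
    qed
  qed
  have ev: "eventually P F" if "\<forall>\<^sub>F n in sequentially. P (e n)" for P
    using that by (intro filter_leD[of F "filtermap e sequentially"]) (auto simp: F_def eventually_filtermap)
  show ?thesis
  proof
    fix u v :: "nat \<Rightarrow> real" assume uv: "Bseq u" "Bseq v"
    then obtain A B where "\<forall>n. norm (u n) \<le> A" "\<forall>n. norm (v n) \<le> B"
      by (meson BseqE)
    then have "Bseq (\<lambda>n. u n + v n)"
      by (intro BseqI'[of _ "A + B"] norm_triangle_mono) auto
    then have "\<forall>\<^sub>F l in F. l (\<lambda>n. u n + v n) = l u + l v"
      using uv by (intro ev) (simp add: e_def)
    then have "((\<lambda>l. l u + l v) \<longlongrightarrow> L (\<lambda>n. u n + v n)) F"
      using lim[of "\<lambda>n. u n + v n"] by (simp cong: tendsto_cong)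
    moreover have "((\<lambda>l. l u + l v) \<longlongrightarrow> L u + L v) F" by (intro tendsto_add lim)
    ultimately show "L (\<lambda>n. u n + v n) = L u + L v" by (rule tendsto_unique[OF F])
  next
    fix c and u :: "nat \<Rightarrow> real" assume u: "Bseq u"
    then have "Bseq (\<lambda>n. c * u n)" by (intro Bseq_mult Bfun_const) 
    then have "\<forall>\<^sub>F l in F. l (\<lambda>n. c * u n) = c * l u"
      using u by (intro ev) (simp add: e_def)
    then have "((\<lambda>l. c * l u) \<longlongrightarrow> L (\<lambda>n. c * u n)) F"
      using lim[of "\<lambda>n. c * u n"] by (simp cong: tendsto_cong)
    moreover have "((\<lambda>l. c * l u) \<longlongrightarrow> c * L u) F" by (intro tendsto_mult_left lim)
    ultimately show "L (\<lambda>n. c * u n) = c * L u" by (rule tendsto_unique[OF F])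
  next
    fix c and u :: "nat \<Rightarrow> real" assume u: "Bseq u" "\<forall>\<^sub>F n in sequentially. c \<le> u n"
    then have "\<forall>\<^sub>F l in F. c \<le> l u" by (intro ev) (simp add: e_def)
    then show "c \<le> L u" by (rule tendsto_lowerbound[OF lim _ F])
  qed
qed

text \<open>
  The closed sets generate the Borel sets and are stable under intersection, and the indicator of a
  closed set is a bounded pointwise limit of continuous functions.
\<close>
lemma borel_probs_eqI:
  assumes M: "M \<in> borel_probs" "N \<in> borel_probs"
    and eq: "\<And>f :: 'a::metric_space \<Rightarrow> real. continuous_on UNIV f \<Longrightarrow> bounded (range f) \<Longrightarrow>
      (\<integral>x. f x \<partial>M) = (\<integral>x. f x \<partial>N)"
  shows "M = N"
proof -
  have sets: "sets M = sigma_sets UNIV (Collect closed)" "sets N = sigma_sets UNIV (Collect closed)"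
    using M by (auto simp: borel_probs_def borel_eq_closed sets_measure_of)
  interpret M: prob_space M using M by (simp add: borel_probs_def)
  interpret N: prob_space N using M by (simp add: borel_probs_def)
  have lim: "(\<lambda>k. \<integral>x. bump (real k) F x \<partial>P) \<longlonglongrightarrow> measure P F"
    if P: "P \<in> borel_probs" and F: "closed F" "F \<noteq> {}" for P and F :: "'a set"
  proof -
    interpret P: prob_space P using P by (simp add: borel_probs_def)
    have sets_P: "sets P = sets borel" using P by (simp add: borel_probs_def)
    have "(\<lambda>k. \<integral>x. bump (real k) F x \<partial>P) \<longlonglongrightarrow> (\<integral>x. indicator F x \<partial>P)"
    proof (rule integral_dominated_convergence[of _ _ _ "\<lambda>_. 1"])
      show "bump (real k) F \<in> borel_measurable P" for k
        unfolding measurable_cong_sets[OF sets_P refl]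
        by (intro borel_measurable_continuous_onI continuous_on_bump)
      show "(indicator F :: 'a \<Rightarrow> real) \<in> borel_measurable P"
        using F(1) by (intro borel_measurable_indicator) (simp add: sets_P)
    qed (use tendsto_bump[OF F] in \<open>auto simp: abs_of_nonneg[OF bump_nonneg] bump_le_1\<close>)
    then show ?thesis using F(1) by (simp add: sets_P)
  qed
  have "emeasure M F = emeasure N F" if "closed F" for F
  proof (cases "F = {}")
    case False
    have "bounded (range (bump (real k) F))" for k
      using bump_le_1[of "real k" F]
      by (auto simp: bounded_iff abs_of_nonneg[OF bump_nonneg] intro!: exI[of _ 1])
    then have "(\<integral>x. bump (real k) F x \<partial>M) = (\<integral>x. bump (real k) F x \<partial>N)" for k
      by (intro eq continuous_on_bump)
    then have "measure M F = measure N F"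
      using LIMSEQ_unique[OF lim[OF M(1) that False]] lim[OF M(2) that False] by simp
    then show ?thesis by (simp add: M.emeasure_eq_measure N.emeasure_eq_measure)
  qed simp
  then show ?thesis
    by (intro measure_eqI_generator_eq[OF _ _ _ sets, of "\<lambda>_. UNIV"]) (auto simp: Int_stable_def)
qed

lemma ziter_succ:
  assumes "bij T"
  shows "T (ziter T k p) = ziter T (k + 1) p"
proof (cases "k \<ge> 0")
  case True
  then show ?thesis by (simp add: ziter_def nat_add_distrib)
next
  case False
  define m where "m = nat (- k - 1)"
  have k: "k = - int m - 1" using False by (simp add: m_def)
  have "ziter T k p = inv T (ziter T (k + 1) p)"
    unfolding k by (cases "m = 0") (auto simp: ziter_def nat_add_distrib)
  then show ?thesis using assms by (simp add: bij_is_surj surj_f_inv_f)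
qed

lemma sum_symmetric_Suc:
  "(\<Sum>k = - int (Suc n)..int (Suc n). h k) =
    h (- int (Suc n)) + (\<Sum>k = - int n..int n. h k) + (h (int (Suc n)) :: real)"
proof -
  have "{- int (Suc n)..int (Suc n)} = insert (- int (Suc n)) (insert (int (Suc n)) {- int n..int n})"
    by auto
  then show ?thesis by simp
qed

lemma abs_avg_le:
  assumes "\<And>x. \<bar>f x\<bar> \<le> B"
  shows "\<bar>avg f T p n\<bar> \<le> B"
proof -
  have "\<bar>\<Sum>k = - int n..int n. f (ziter T k p)\<bar> \<le> (\<Sum>k = - int n..int n. B)"
    by (intro order.trans[OF sum_abs] sum_mono assms)
  also have "\<dots> = B * (2 * real n + 1)" by simp
  finally show ?thesis by (simp add: avg_def field_simps)
qed

lemma avg_add: "avg (\<lambda>x. f x + g x) T p n = avg f T p n + avg g T p n"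
  by (simp add: avg_def sum.distrib add_divide_distrib)

lemma avg_scale: "avg (\<lambda>x. c * f x) T p n = c * avg f T p n"
  by (simp add: avg_def sum_distrib_left)

lemma avg_mono: "(\<And>k. f (ziter T k p) \<le> g (ziter T k p)) \<Longrightarrow> avg f T p n \<le> avg g T p n"
  unfolding avg_def by (intro divide_right_mono sum_mono) auto

lemma avg_const: "avg (\<lambda>_. c) T p n = c"
  by (simp add: avg_def field_simps)

text \<open>
  Shifting the window by one changes only its two end terms.
\<close>
lemma avg_shift:
  assumes T: "bij T" and B: "\<And>x. \<bar>f x\<bar> \<le> B"
  shows "(\<lambda>n. avg (\<lambda>x. f (T x)) T p n - avg f T p n) \<longlonglongrightarrow> 0"
proof (rule Lim_null_comparison)
  let ?h = "\<lambda>k. f (ziter T k p)"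
  have "(\<Sum>k = - int n..int n. ?h (k + 1)) - (\<Sum>k = - int n..int n. ?h k) = ?h (int n + 1) - ?h (- int n)" for n
    by (induction n) (simp_all add: sum_symmetric_Suc del: of_nat_Suc, simp_all add: algebra_simps)
  then have "avg (\<lambda>x. f (T x)) T p n - avg f T p n = (?h (int n + 1) - ?h (- int n)) / (2 * real n + 1)" for n
    unfolding avg_def ziter_succ[OF T] diff_divide_distrib[symmetric] by simp
  moreover have "\<bar>?h k - ?h l\<bar> \<le> 2 * B" for k l
    using B[of "ziter T k p"] B[of "ziter T l p"] by linarith
  ultimately show "\<forall>\<^sub>F n in sequentially. norm (avg (\<lambda>x. f (T x)) T p n - avg f T p n) \<le> 2 * B / (2 * real n + 1)"
    by (auto intro!: always_eventually divide_right_mono)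
  show "(\<lambda>n. 2 * B / (2 * real n + 1)) \<longlonglongrightarrow> 0"
    by real_asymp
qed

text \<open>
  A generalized limit of the orbit averages of \<open>f\<close> is a normalized positive functional of \<open>f\<close>, hence
  the integral against a probability measure, which is invariant because a shift of the window does
  not change the limit.  The second conclusion, also for \<open>- f\<close>, says that this
  integral lies between the lower and the upper limit of the averages.
\<close>
theorem krylov_bogolyubov:
  fixes T :: "'a::metric_space \<Rightarrow> 'a"
  assumes K: "compact (UNIV :: 'a set)" and T: "bij T" "continuous_on UNIV T"
  obtains \<mu> where "\<mu> \<in> invariant_probs T"
    "\<And>f c. continuous_on UNIV f \<Longrightarrow> \<forall>\<^sub>F n in sequentially. c \<le> avg f T p n \<Longrightarrow> c \<le> (\<integral>x. f x \<partial>\<mu>)"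
proof -
  obtain L :: "(nat \<Rightarrow> real) \<Rightarrow> real" where L:
    "\<And>u v. Bseq u \<Longrightarrow> Bseq v \<Longrightarrow> L (\<lambda>n. u n + v n) = L u + L v"
    "\<And>c u. Bseq u \<Longrightarrow> L (\<lambda>n. c * u n) = c * L u"
    "\<And>c u. Bseq u \<Longrightarrow> \<forall>\<^sub>F n in sequentially. c \<le> u n \<Longrightarrow> c \<le> L u"
    using exists_generalized_limit by blast
  have L_upper: "L u \<le> c" if "Bseq u" "\<forall>\<^sub>F n in sequentially. u n \<le> c" for u c
    using L(3)[of "\<lambda>n. (-1) * u n" "-c"] L(2)[of u "-1"] that by (simp add: Bseq_minus_iff)
  define \<Lambda> where "\<Lambda> f = L (avg f T p)" for f
  have bound: "\<exists>B. \<forall>x. \<bar>f x\<bar> \<le> B" if "continuous_on UNIV f" for f :: "'a \<Rightarrow> real"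
    using compact_imp_bounded[OF compact_continuous_image[OF that K]] by (auto simp: bounded_iff)
  have Bseq_avg: "Bseq (avg f T p)" if "continuous_on UNIV f" for f
    using bound[OF that] by (metis BseqI' abs_avg_le real_norm_def)
  interpret normalized_positive_functional \<Lambda>
  proof
    fix f g :: "'a \<Rightarrow> real" and c
    assume f: "continuous_on UNIV f"
    show "\<Lambda> (\<lambda>x. f x + g x) = \<Lambda> f + \<Lambda> g" if "continuous_on UNIV g"
      using L(1)[OF Bseq_avg[OF f] Bseq_avg[OF that]] by (simp add: \<Lambda>_def avg_add[abs_def])
    show "\<Lambda> (\<lambda>x. c * f x) = c * \<Lambda> f"
      using L(2)[OF Bseq_avg[OF f]] by (simp add: \<Lambda>_def avg_scale[abs_def])
    show "0 \<le> \<Lambda> f" if "\<And>x. 0 \<le> f x"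
      unfolding \<Lambda>_def using that by (intro L(3) Bseq_avg f) (simp add: avg_def sum_nonneg)
  next
    have "Bseq (\<lambda>_. 1 :: real)" by simp
    then show "\<Lambda> (\<lambda>_. 1) = 1"
      using L(3)[of "\<lambda>_. 1" 1] L_upper[of "\<lambda>_. 1" 1] by (simp add: \<Lambda>_def avg_const[abs_def])
  qed (rule K)
  have T_meas: "T \<in> borel_measurable borel" using T(2) by (rule borel_measurable_continuous_onI)
  have T_meas': "T \<in> measurable riesz borel" using T_meas measurable_cong_sets[OF sets_riesz refl] by blast
  have inv: "\<Lambda> (\<lambda>x. f (T x)) = \<Lambda> f" if f: "continuous_on UNIV f" for f
  proof -
    have fT: "continuous_on UNIV (\<lambda>x. f (T x))"
      using continuous_on_compose2[OF f T(2)] by simp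
    obtain B where B: "\<And>x. \<bar>f x\<bar> \<le> B" using bound[OF f] by blast
    define d where "d n = avg (\<lambda>x. f (T x)) T p n - avg f T p n" for n
    have d: "d \<longlonglongrightarrow> 0" unfolding d_def by (rule avg_shift[OF T(1) B])
    have Bseq_d: "Bseq d" using d by (intro convergent_imp_Bseq convergentI)
    have "\<bar>L d\<bar> \<le> e" if "e > 0" for e
    proof -
      have "\<forall>\<^sub>F n in sequentially. d n < e" "\<forall>\<^sub>F n in sequentially. - e < d n"
        using order_tendstoD[OF d] that by auto
      then show ?thesis
        using L_upper[OF Bseq_d, of e] L(3)[OF Bseq_d, of "- e"]
        by (simp add: abs_le_iff eventually_mono less_imp_le minus_le_iff)
    qed
    then have "L d = 0" using dense_ge[of 0 "\<bar>L d\<bar>"] by simp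
    moreover have "\<Lambda> (\<lambda>x. f (T x)) = L (\<lambda>n. d n + avg f T p n)"
      unfolding \<Lambda>_def d_def by simp
    ultimately show ?thesis
      using L(1)[OF Bseq_d Bseq_avg[OF f]] by (simp add: \<Lambda>_def)
  qed
  have R: "riesz \<in> borel_probs" by (simp add: borel_probs_def prob_space_riesz sets_riesz)
  have D: "distr riesz borel T \<in> borel_probs"
    using prob_space.prob_space_distr[OF prob_space_riesz T_meas'] by (simp add: borel_probs_def)
  have "distr riesz borel T = riesz"
  proof (rule borel_probs_eqI[OF D R])
    fix f :: "'a \<Rightarrow> real" assume f: "continuous_on UNIV f"
    have "(\<integral>x. f x \<partial>distr riesz borel T) = (\<integral>x. f (T x) \<partial>riesz)"
      by (intro integral_distr T_meas' borel_measurable_continuous_onI f)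
    also have "\<dots> = \<Lambda> (\<lambda>x. f (T x))"
      using continuous_on_compose2[OF f T(2)] by (intro integral_riesz) simp
    also have "\<dots> = (\<integral>x. f x \<partial>riesz)" using inv[OF f] integral_riesz[OF f] by simp
    finally show "(\<integral>x. f x \<partial>distr riesz borel T) = (\<integral>x. f x \<partial>riesz)" .
  qed
  with R have "riesz \<in> invariant_probs T" by (simp add: invariant_probs_def)
  moreover have "c \<le> (\<integral>x. f x \<partial>riesz)"
    if "continuous_on UNIV f" "\<forall>\<^sub>F n in sequentially. c \<le> avg f T p n" for f c
    using L(3)[OF Bseq_avg[OF that(1)] that(2)] integral_riesz[OF that(1)] by (simp add: \<Lambda>_def)
  ultimately show thesis using that by blast
qed

section \<open>Birkhoff's convergence theorem\<close>

definition orbit_sum :: "('a \<Rightarrow> 'a) \<Rightarrow> ('a \<Rightarrow> real) \<Rightarrow> nat \<Rightarrow> 'a \<Rightarrow> real" where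
  "orbit_sum T f n x = (\<Sum>k<n. f ((T ^^ k) x))"

text \<open>
  The maximum of \<open>orbit_sum T f k x\<close> over \<open>k \<le> n\<close>, computed by splitting off the first point of the
  orbit.
\<close>
primrec max_sum :: "('a \<Rightarrow> 'a) \<Rightarrow> ('a \<Rightarrow> real) \<Rightarrow> nat \<Rightarrow> 'a \<Rightarrow> real" where
  "max_sum T f 0 x = 0"
| "max_sum T f (Suc n) x = max 0 (f x + max_sum T f n (T x))"

lemma orbit_sum_Suc: "orbit_sum T f (Suc n) x = f x + orbit_sum T f n (T x)"
  unfolding orbit_sum_def by (subst sum.lessThan_Suc_shift) (simp add: funpow_swap1)

lemma max_sum_nonneg: "0 \<le> max_sum T f n x"
  by (cases n) auto

lemma max_sum_mono: "max_sum T f n x \<le> max_sum T f (Suc n) x"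
proof (induction n arbitrary: x)
  case (Suc n)
  have "max_sum T f n (T x) \<le> max_sum T f (Suc n) (T x)" by (rule Suc.IH)
  then show ?case by (simp only: max_sum.simps(2)[of T f "Suc n"] max_sum.simps(2)[of T f n x])
qed simp

lemma max_sum_le:
  assumes "\<And>x. \<bar>f x\<bar> \<le> B"
  shows "max_sum T f n x \<le> real n * B"
proof (induction n arbitrary: x)
  case (Suc n)
  have "0 \<le> B" using assms[of x] by simp
  then show ?case using Suc.IH[of "T x"] assms[of x] by (auto simp: algebra_simps abs_le_iff)
qed simp

lemma orbit_sum_le_max_sum: "orbit_sum T f n x \<le> max_sum T f n x"
  by (induction n arbitrary: x) (auto simp: orbit_sum_Suc orbit_sum_def[of T f 0] intro: max.coboundedI2)

lemma max_sum_attained: "\<exists>k. max_sum T f n x = orbit_sum T f k x"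
proof (induction n arbitrary: x)
  case 0
  show ?case by (intro exI[of _ 0]) (simp add: orbit_sum_def)
next
  case (Suc n)
  obtain k where "max_sum T f n (T x) = orbit_sum T f k (T x)" using Suc by blast
  then show ?case
    by (cases "0 \<le> f x + max_sum T f n (T x)")
      (auto simp: orbit_sum_Suc max_def orbit_sum_def[of T f 0] intro: exI[of _ "Suc k"] exI[of _ 0])
qed

locale measure_preserving = prob_space M for M :: "'a measure" +
  fixes T :: "'a \<Rightarrow> 'a"
  assumes measurable_T [measurable]: "T \<in> measurable M M"
    and distr_T: "distr M M T = M"
begin

lemma integral_compose:
  fixes g :: "'a \<Rightarrow> real"
  assumes [measurable]: "g \<in> borel_measurable M"
  shows "(\<integral>x. g (T x) \<partial>M) = (\<integral>x. g x \<partial>M)"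
  using integral_distr[OF measurable_T assms] distr_T by simp

lemma measurable_iter [measurable]: "T ^^ k \<in> measurable M M"
  by (induction k) (auto simp: id_def)

lemma measurable_orbit_sum [measurable]:
  assumes [measurable]: "f \<in> borel_measurable M"
  shows "orbit_sum T f n \<in> borel_measurable M"
  unfolding orbit_sum_def by measurable

lemma measurable_max_sum [measurable]:
  assumes [measurable]: "f \<in> borel_measurable M"
  shows "max_sum T f n \<in> borel_measurable M"
  by (induction n) simp_all

text \<open>
  On the set \<open>E n\<close> where \<open>max_sum T f n\<close> is positive the recursion and monotonicity in \<open>n\<close> give
  \<open>max_sum T f n x - max_sum T f n (T x) \<le> f x\<close>; off this set the left side is at most \<open>0\<close>.  By
  invariance the left side has integral \<open>0\<close>.  The claim is the limit \<open>n \<rightarrow> \<infinity>\<close>.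
\<close>
lemma maximal_ergodic:
  assumes [measurable]: "f \<in> borel_measurable M" and B: "\<And>x. \<bar>f x\<bar> \<le> B"
  shows "0 \<le> (\<integral>x. indicator {x. \<exists>n. 0 < orbit_sum T f n x} x * f x \<partial>M)"
proof -
  let ?E = "\<lambda>n. {x. 0 < max_sum T f n x}"
  have int: "integrable M (max_sum T f n)" for n
    using max_sum_nonneg[of T f n] max_sum_le[of f B, OF B]
    by (intro integrable_const_bound[of _ "real n * B"]) auto
  have int_T: "integrable M (\<lambda>x. max_sum T f n (T x))" for n
    using max_sum_nonneg[of T f n] max_sum_le[of f B, OF B]
    by (intro integrable_const_bound[of _ "real n * B"]) auto
  have ind_le: "\<bar>indicator E x * f x\<bar> \<le> B" for E x
    using B[of x] by (auto simp: indicator_def)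
  have E [measurable]: "?E n \<inter> space M \<in> sets M" for n by measurable
  have meas: "(\<lambda>x. indicator (?E n) x * f x) \<in> borel_measurable M" for n
    by measurable
  have step: "0 \<le> (\<integral>x. indicator (?E n) x * f x \<partial>M)" for n
  proof -
    have "0 = (\<integral>x. max_sum T f n x \<partial>M) - (\<integral>x. max_sum T f n (T x) \<partial>M)"
      by (subst integral_compose) auto
    also have "\<dots> = (\<integral>x. max_sum T f n x - max_sum T f n (T x) \<partial>M)"
      by (intro Bochner_Integration.integral_diff[symmetric] int int_T)
    also have "\<dots> \<le> (\<integral>x. indicator (?E n) x * f x \<partial>M)"
    proof (intro integral_mono Bochner_Integration.integrable_diff int int_T)
      show "integrable M (\<lambda>x. indicator (?E n) x * f x)"
        using ind_le meas by (intro integrable_const_bound[of _ B]) auto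
      fix x
      show "max_sum T f n x - max_sum T f n (T x) \<le> indicator (?E n) x * f x"
      proof (cases "0 < max_sum T f n x")
        case True
        have "max_sum T f n x \<le> max_sum T f (Suc n) x" by (rule max_sum_mono)
        then show ?thesis using True by (auto simp: max_def split: if_splits)
      next
        case False
        then show ?thesis using max_sum_nonneg[of T f n "T x"] by simp
      qed
    qed
    finally show ?thesis .
  qed
  have "(\<lambda>n. \<integral>x. indicator (?E n) x * f x \<partial>M) \<longlonglongrightarrow>
      (\<integral>x. indicator {x. \<exists>n. 0 < orbit_sum T f n x} x * f x \<partial>M)"
  proof (rule integral_dominated_convergence[of _ _ _ "\<lambda>_. B"])
    show "AE x in M. (\<lambda>n. indicator (?E n) x * f x)
        \<longlonglongrightarrow> indicator {x. \<exists>n. 0 < orbit_sum T f n x} x * f x"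
    proof (intro AE_I2 tendsto_mult tendsto_const)
      fix x
      show "(\<lambda>n. indicator (?E n) x) \<longlonglongrightarrow> (indicator {x. \<exists>n. 0 < orbit_sum T f n x} x :: real)"
      proof (cases "\<exists>n. 0 < orbit_sum T f n x")
        case True
        then obtain k where "0 < max_sum T f k x" using orbit_sum_le_max_sum by (metis less_le_trans)
        moreover have "max_sum T f k x \<le> max_sum T f n x" if "k \<le> n" for n
          by (rule lift_Suc_mono_le[of "\<lambda>n. max_sum T f n x", OF max_sum_mono that])
        ultimately have "\<forall>n\<ge>k. 0 < max_sum T f n x" by (metis less_le_trans)
        then show ?thesis using True
          by (intro tendsto_eventually) (auto simp: eventually_sequentially intro!: exI[of _ k])
      next
        case False
        then have "\<not> 0 < max_sum T f n x" for n using max_sum_attained by metis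
        then show ?thesis using False by simp
      qed
    qed
  qed (use ind_le meas in auto)
  then show ?thesis using step by (intro LIMSEQ_le_const) auto
qed

text \<open>
  Cutting \<open>f\<close> off outside an invariant set does not change its orbit sums inside.
\<close>
lemma maximal_ergodic_invariant:
  assumes [measurable]: "f \<in> borel_measurable M" "A \<in> sets M"
    and B: "\<And>x. \<bar>f x\<bar> \<le> B"
    and inv: "\<And>x. x \<in> space M \<Longrightarrow> T x \<in> A \<longleftrightarrow> x \<in> A"
    and pos: "\<And>x. x \<in> A \<Longrightarrow> \<exists>n. 0 < orbit_sum T f n x"
  shows "0 \<le> (\<integral>x. indicator A x * f x \<partial>M)"
proof -
  define g where "g x = indicator A x * f x" for x
  have g_meas [measurable]: "g \<in> borel_measurable M" unfolding g_def by measurable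
  have iter: "(T ^^ k) x \<in> A \<longleftrightarrow> x \<in> A" if "x \<in> space M" for k x
  proof (induction k)
    case (Suc k)
    have "(T ^^ k) x \<in> space M" using measurable_space[OF measurable_iter that] .
    then show ?case using inv Suc by simp
  qed simp
  have "orbit_sum T g n x = orbit_sum T f n x" if "x \<in> A" for n x
    using that iter[of x] sets.sets_into_space[OF assms(2)]
    by (auto simp: orbit_sum_def g_def indicator_def intro!: sum.cong)
  then have eq: "indicator {x. \<exists>n. 0 < orbit_sum T g n x} x * g x = g x" for x
    using pos[of x] by (auto simp: g_def indicator_def)
  have "\<bar>g x\<bar> \<le> B" for x using B[of x] by (auto simp: g_def indicator_def)
  from maximal_ergodic[OF g_meas this] show ?thesis
    unfolding eq by (simp add: g_def)
qed

lemma integral_orbit_sum: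
  assumes [measurable]: "f \<in> borel_measurable M" and B: "\<And>x. \<bar>f x\<bar> \<le> B"
  shows "integrable M (orbit_sum T f n)" "(\<integral>x. orbit_sum T f n x \<partial>M) = real n * (\<integral>x. f x \<partial>M)"
proof -
  have int: "integrable M (\<lambda>x. f ((T ^^ k) x))" for k
    using B by (intro integrable_const_bound[of _ B]) auto
  have eq: "(\<integral>x. f ((T ^^ k) x) \<partial>M) = (\<integral>x. f x \<partial>M)" for k
  proof (induction k)
    case (Suc k)
    have "(\<integral>x. f ((T ^^ k) (T x)) \<partial>M) = (\<integral>x. f ((T ^^ k) x) \<partial>M)"
      by (rule integral_compose) measurable
    then show ?case using Suc by (simp add: funpow_swap1)
  qed simp
  show "integrable M (orbit_sum T f n)" "(\<integral>x. orbit_sum T f n x \<partial>M) = real n * (\<integral>x. f x \<partial>M)"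
    unfolding orbit_sum_def[abs_def] by (simp_all add: int eq)
qed

text \<open>
  For \<open>a < b\<close>, the set \<open>E\<close> on which the averages have lower limit below \<open>a\<close> and upper limit above \<open>b\<close>
  is invariant.  At every point of \<open>E\<close> both \<open>f - b\<close> and \<open>a - f\<close> have a positive orbit sum, so both have nonnegative
  integral over \<open>E\<close>; but their sum is the negative constant \<open>a - b\<close>, so \<open>E\<close> is a null set.
\<close>
theorem birkhoff_convergent:
  assumes f [measurable]: "f \<in> borel_measurable M" and B: "\<And>x. \<bar>f x\<bar> \<le> B"
  shows "AE x in M. convergent (\<lambda>n. orbit_sum T f n x / real n)"
proof -
  define A where "A x n = ereal (orbit_sum T f n x / real n)" for x n
  define up where "up x = limsup (A x)" for x
  define lo where "lo x = liminf (A x)" for x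
  have A_meas [measurable]: "(\<lambda>x. A x n) \<in> borel_measurable M" for n
    unfolding A_def by measurable
  have [measurable]: "up \<in> borel_measurable M" "lo \<in> borel_measurable M"
    unfolding up_def lo_def by measurable
  have sum_bound: "\<bar>orbit_sum T f n x\<bar> \<le> real n * B" for n x
    unfolding orbit_sum_def using B sum_bounded_above[of "{..<n}" "\<lambda>k. \<bar>f ((T ^^ k) x)\<bar>" B]
    by (intro order.trans[OF sum_abs]) auto
  have A_T: "A (T x) = (\<lambda>n. ereal ((f ((T ^^ n) x) - f x) / real n) + A x n)" for x
  proof
    fix n
    have "orbit_sum T f (Suc n) x = orbit_sum T f n x + f ((T ^^ n) x)"
      by (simp add: orbit_sum_def)
    then have "orbit_sum T f n (T x) = (f ((T ^^ n) x) - f x) + orbit_sum T f n x"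
      by (simp add: orbit_sum_Suc)
    then show "A (T x) n = ereal ((f ((T ^^ n) x) - f x) / real n) + A x n"
      by (simp add: A_def add_divide_distrib)
  qed
  have small: "(\<lambda>n. ereal ((f ((T ^^ n) x) - f x) / real n)) \<longlonglongrightarrow> 0" for x
  proof -
    have "(\<lambda>n. (f ((T ^^ n) x) - f x) / real n) \<longlonglongrightarrow> 0"
    proof (rule Lim_null_comparison)
      show "\<forall>\<^sub>F n in sequentially. norm ((f ((T ^^ n) x) - f x) / real n) \<le> 2 * B / real n"
      proof (intro always_eventually allI)
        fix n
        have "\<bar>f ((T ^^ n) x) - f x\<bar> \<le> 2 * B" using B[of x] B[of "(T ^^ n) x"] by linarith
        then show "norm ((f ((T ^^ n) x) - f x) / real n) \<le> 2 * B / real n"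
          by (auto intro!: divide_right_mono)
      qed
      show "(\<lambda>n. 2 * B / real n) \<longlonglongrightarrow> 0" by (rule lim_const_over_n)
    qed
    then show ?thesis by (simp add: zero_ereal_def)
  qed
  have inv: "up (T x) = up x" "lo (T x) = lo x" for x
    unfolding up_def lo_def A_T
    by (simp_all add: ereal_limsup_lim_add[OF small] ereal_liminf_lim_add[OF small])
  have up_pos: "\<exists>n. 0 < orbit_sum T (\<lambda>x. f x - b) n x" if "ereal b < up x" for b x
  proof (rule ccontr)
    assume neg: "\<not> ?thesis"
    have "A x n \<le> ereal b" if "0 < n" for n
    proof -
      have "orbit_sum T (\<lambda>x. f x - b) n x \<le> 0" using neg by (simp add: not_less)
      then have "orbit_sum T f n x \<le> real n * b" by (simp add: orbit_sum_def sum_subtractf)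
      then show ?thesis using that by (simp add: A_def field_simps)
    qed
    then have "up x \<le> ereal b"
      unfolding up_def by (intro Limsup_bounded) (auto simp: eventually_sequentially intro!: exI[of _ 1])
    then show False using that by simp
  qed
  have lo_pos: "\<exists>n. 0 < orbit_sum T (\<lambda>x. a - f x) n x" if "lo x < ereal a" for a x
  proof (rule ccontr)
    assume neg: "\<not> ?thesis"
    have "ereal a \<le> A x n" if "0 < n" for n
    proof -
      have "orbit_sum T (\<lambda>x. a - f x) n x \<le> 0" using neg by (simp add: not_less)
      then have "real n * a \<le> orbit_sum T f n x" by (simp add: orbit_sum_def sum_subtractf)
      then show ?thesis using that by (simp add: A_def field_simps)
    qed
    then have "ereal a \<le> lo x"
      unfolding lo_def by (intro Liminf_bounded) (auto simp: eventually_sequentially intro!: exI[of _ 1])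
    then show False using that by simp
  qed
  have no_gap: "AE x in M. \<not> (lo x < ereal a \<and> ereal b < up x)" if "a < b" for a b
  proof -
    define E where "E = {x \<in> space M. lo x < ereal a \<and> ereal b < up x}"
    have E [measurable]: "E \<in> sets M" unfolding E_def by measurable
    have E_inv: "T x \<in> E \<longleftrightarrow> x \<in> E" if "x \<in> space M" for x
      using that measurable_space[OF measurable_T that] by (auto simp: E_def inv)
    have bound: "\<bar>f x - b\<bar> \<le> B + \<bar>b\<bar>" "\<bar>a - f x\<bar> \<le> B + \<bar>a\<bar>" for x
      using B[of x] by linarith+
    have int_E: "integrable M (\<lambda>x. indicator E x * g x)"
      if "g \<in> borel_measurable M" "\<And>x. \<bar>g x\<bar> \<le> C" for g :: "'a \<Rightarrow> real" and C
      using that(1)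
      by (intro integrable_const_bound[of _ C])
        (auto simp: indicator_def that(2) order.trans[OF abs_ge_zero that(2)])
    have int: "integrable M (\<lambda>x. indicator E x * (f x - b))" "integrable M (\<lambda>x. indicator E x * (a - f x))"
      by (intro int_E[OF _ bound(1)] int_E[OF _ bound(2)]; measurable)+
    have "0 \<le> (\<integral>x. indicator E x * (f x - b) \<partial>M)"
      by (rule maximal_ergodic_invariant[OF _ E bound(1) E_inv]) (auto simp: E_def intro: up_pos)
    moreover have "0 \<le> (\<integral>x. indicator E x * (a - f x) \<partial>M)"
      by (rule maximal_ergodic_invariant[OF _ E bound(2) E_inv]) (auto simp: E_def intro: lo_pos)
    ultimately have "0 \<le> (\<integral>x. indicator E x * (f x - b) + indicator E x * (a - f x) \<partial>M)"
      by (subst Bochner_Integration.integral_add[OF int]) simp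
    also have "\<dots> = (\<integral>x. (a - b) * indicator E x \<partial>M)"
      by (intro Bochner_Integration.integral_cong refl) (simp add: algebra_simps)
    also have "\<dots> = (a - b) * prob E" by simp
    finally have "prob E = 0"
      using \<open>a < b\<close> measure_nonneg[of M E] by (auto simp: zero_le_mult_iff)
    then have "AE x in M. x \<notin> E" by (simp add: prob_eq_0[OF E])
    then show ?thesis by (auto simp: E_def)
  qed
  have "AE x in M. \<forall>q r :: rat. q < r \<longrightarrow> \<not> (lo x < ereal (of_rat q) \<and> ereal (of_rat r) < up x)"
    unfolding AE_all_countable by (intro allI AE_impI no_gap) (simp add: of_rat_less)
  then show ?thesis
  proof eventually_elim
    case (elim x)
    have "lo x \<le> up x" unfolding lo_def up_def by (intro Liminf_le_Limsup) simp
    moreover have "\<not> lo x < up x"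
    proof
      assume "lo x < up x"
      then obtain q where q: "lo x < ereal (of_rat q)" "ereal (of_rat q) < up x"
        using ereal_dense3 by blast
      then obtain r where r: "ereal (of_rat q) < ereal (of_rat r)" "ereal (of_rat r) < up x"
        using ereal_dense3 by blast
      then show False using elim q by (auto simp: of_rat_less)
    qed
    ultimately have "lo x = up x" by simp
    then obtain l where l: "A x \<longlonglongrightarrow> l"
      using convergent_ereal[of "A x"] by (auto simp: convergent_def lo_def up_def)
    have "\<bar>orbit_sum T f n x / real n\<bar> \<le> B" for n
      using sum_bound[of n x] B[of x] by (cases "n = 0") (auto simp: field_simps abs_le_iff)
    from this[unfolded abs_le_iff] have "A x n \<in> {ereal (-B)..ereal B}" for n
      by (simp add: A_def minus_le_iff)
    then have "l \<in> {ereal (-B)..ereal B}"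
      by (intro Lim_in_closed_set[OF _ _ _ l]) auto
    then obtain r where "l = ereal r" by (cases l) auto
    then show ?case using l unfolding A_def convergent_def by (auto simp: lim_ereal)
  qed
qed

end

section \<open>Points with large two-sided averages\<close>

text \<open>
  Reduces two-sided averages to the forward orbits of \<open>S\<close> and \<open>inv S\<close>, which share the term \<open>f x\<close>.
\<close>
lemma avg_eq_orbit_sums:
  "avg f S x n =
    (orbit_sum S f (Suc n) x + orbit_sum (inv S) f (Suc n) x - f x) / (2 * real n + 1)"
proof -
  have "(\<Sum>k = - int n..int n. f (ziter S k x)) =
      orbit_sum S f (Suc n) x + orbit_sum (inv S) f (Suc n) x - f x"
  proof (induction n)
    case 0
    show ?case by (simp add: orbit_sum_def ziter_def)
  next
    case (Suc n)
    have "ziter S (- int (Suc n)) x = (inv S ^^ Suc n) x" "ziter S (int (Suc n)) x = (S ^^ Suc n) x"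
      by (simp_all add: ziter_def nat_add_distrib del: funpow.simps)
    moreover have "orbit_sum R f (Suc (Suc n)) x = orbit_sum R f (Suc n) x + f ((R ^^ Suc n) x)" for R
      by (simp add: orbit_sum_def)
    ultimately show ?case
      unfolding sum_symmetric_Suc by (simp only: Suc.IH)
  qed
  then show ?thesis by (simp add: avg_def)
qed

lemma measure_preserving_of_invariant:
  assumes "\<nu> \<in> invariant_probs S" "continuous_on UNIV S"
  shows "measure_preserving \<nu> S"
proof -
  have \<nu>: "prob_space \<nu>" "sets \<nu> = sets borel" "distr \<nu> borel S = \<nu>"
    using assms(1) by (auto simp: invariant_probs_def borel_probs_def)
  have "S \<in> borel_measurable borel"
    using assms(2) by (rule borel_measurable_continuous_onI)
  then have "S \<in> measurable \<nu> \<nu>"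
    using measurable_cong_sets[OF \<nu>(2) \<nu>(2)] by blast
  moreover have "distr \<nu> \<nu> S = \<nu>"
    using \<nu>(3) distr_cong[OF refl \<nu>(2), of \<nu> S S] by simp
  ultimately show ?thesis
    using \<nu>(1) by (simp add: measure_preserving_def measure_preserving_axioms_def)
qed

lemma invariant_probs_inv:
  assumes \<nu>: "\<nu> \<in> invariant_probs S"
    and S: "bij S" "continuous_on UNIV S" "continuous_on UNIV (inv S)"
  shows "\<nu> \<in> invariant_probs (inv S)"
proof -
  have b: "\<nu> \<in> borel_probs" "distr \<nu> borel S = \<nu>" and sets: "sets \<nu> = sets borel"
    using \<nu> by (auto simp: invariant_probs_def borel_probs_def)
  have meas: "S \<in> borel_measurable borel" "inv S \<in> borel_measurable borel"
    using S by (auto intro: borel_measurable_continuous_onI)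
  then have "S \<in> measurable \<nu> borel"
    using measurable_cong_sets[OF sets refl] by blast
  then have "distr (distr \<nu> borel S) borel (inv S) = distr \<nu> borel (inv S \<circ> S)"
    by (rule distr_distr[OF meas(2)])
  also have "\<dots> = distr \<nu> \<nu> (\<lambda>x. x)"
    using S(1) by (intro distr_cong) (simp_all add: sets bij_is_inj)
  finally have "distr \<nu> borel (inv S) = \<nu>" using b(2) distr_id by (simp add: id_def)
  then show ?thesis using b(1) by (simp add: invariant_probs_def)
qed

lemma AE_convergent_avg:
  assumes \<nu>: "\<nu> \<in> invariant_probs S"
    and S: "bij S" "continuous_on UNIV S" "continuous_on UNIV (inv S)"
    and f: "f \<in> borel_measurable borel" "\<And>x. \<bar>f x\<bar> \<le> B"
  shows "AE x in \<nu>. convergent (avg f S x)"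
proof -
  interpret F: measure_preserving \<nu> S
    by (rule measure_preserving_of_invariant[OF \<nu> S(2)])
  interpret B: measure_preserving \<nu> "inv S"
    by (rule measure_preserving_of_invariant[OF invariant_probs_inv[OF \<nu> S] S(3)])
  have "sets \<nu> = sets borel" using \<nu> by (auto simp: invariant_probs_def borel_probs_def)
  then have f': "f \<in> borel_measurable \<nu>" using f(1) measurable_cong_sets by blast
  from F.birkhoff_convergent[OF f' f(2)] B.birkhoff_convergent[OF f' f(2)] show ?thesis
  proof eventually_elim
    case (elim x)
    then obtain a b where
      a: "(\<lambda>n. orbit_sum S f n x / real n) \<longlonglongrightarrow> a" and
      b: "(\<lambda>n. orbit_sum (inv S) f n x / real n) \<longlonglongrightarrow> b"
      by (auto simp: convergent_def)
    have half: "(\<lambda>n. real (Suc n) / (2 * real n + 1)) \<longlonglongrightarrow> 1 / 2" by real_asymp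
    have zero: "(\<lambda>n. f x / (2 * real n + 1)) \<longlonglongrightarrow> 0" by real_asymp
    have "avg f S x = (\<lambda>n. orbit_sum S f (Suc n) x / real (Suc n) * (real (Suc n) / (2 * real n + 1))
        + orbit_sum (inv S) f (Suc n) x / real (Suc n) * (real (Suc n) / (2 * real n + 1))
        - f x / (2 * real n + 1))"
      unfolding avg_eq_orbit_sums by (intro ext) (simp add: add_divide_distrib diff_divide_distrib del: of_nat_Suc)
    moreover have "(\<lambda>n. orbit_sum S f (Suc n) x / real (Suc n) * (real (Suc n) / (2 * real n + 1))
        + orbit_sum (inv S) f (Suc n) x / real (Suc n) * (real (Suc n) / (2 * real n + 1))
        - f x / (2 * real n + 1)) \<longlonglongrightarrow> a * (1 / 2) + b * (1 / 2) - 0"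
      by (intro tendsto_diff tendsto_add tendsto_mult half zero LIMSEQ_Suc[OF a] LIMSEQ_Suc[OF b])
    ultimately show ?case unfolding convergent_def by metis
  qed
qed

lemma integral_avg:
  assumes \<nu>: "\<nu> \<in> invariant_probs S"
    and S: "bij S" "continuous_on UNIV S" "continuous_on UNIV (inv S)"
    and f: "f \<in> borel_measurable \<nu>" "\<And>x. \<bar>f x\<bar> \<le> B"
  shows "(\<integral>x. avg f S x n \<partial>\<nu>) = (\<integral>x. f x \<partial>\<nu>)"
proof -
  interpret F: measure_preserving \<nu> S
    by (rule measure_preserving_of_invariant[OF \<nu> S(2)])
  interpret B: measure_preserving \<nu> "inv S"
    by (rule measure_preserving_of_invariant[OF invariant_probs_inv[OF \<nu> S] S(3)])
  have "integrable \<nu> f" using f by (intro F.integrable_const_bound[of _ B]) auto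
  then show ?thesis
    unfolding avg_eq_orbit_sums
    using F.integral_orbit_sum[OF f, of "Suc n"] B.integral_orbit_sum[OF f, of "Suc n"]
    by (simp add: field_simps)
qed

text \<open>
  The limit of the averages of \<open>f + c * g\<close> has the same integral as \<open>f + c * g\<close>, by bounded
  convergence, so it cannot lie below this integral almost everywhere.
\<close>
lemma exists_point_above_mean:
  fixes S :: "'a::metric_space \<Rightarrow> 'a"
  assumes \<nu>: "\<nu> \<in> invariant_probs S"
    and S: "bij S" "continuous_on UNIV S" "continuous_on UNIV (inv S)"
    and f: "f \<in> borel_measurable borel" "\<And>x. \<bar>f x\<bar> \<le> B"
    and g: "g \<in> borel_measurable borel" "\<And>x. \<bar>g x\<bar> \<le> D"
  obtains q a b where "avg f S q \<longlonglongrightarrow> a" "avg g S q \<longlonglongrightarrow> b"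
    "(\<integral>x. f x \<partial>\<nu>) + c * (\<integral>x. g x \<partial>\<nu>) \<le> a + c * b"
proof -
  interpret F: measure_preserving \<nu> S
    by (rule measure_preserving_of_invariant[OF \<nu> S(2)])
  interpret B: measure_preserving \<nu> "inv S"
    by (rule measure_preserving_of_invariant[OF invariant_probs_inv[OF \<nu> S] S(3)])
  define h where "h x = f x + c * g x" for x
  have h: "h \<in> borel_measurable borel" unfolding h_def using f(1) g(1) by measurable
  have h_bound: "\<bar>h x\<bar> \<le> B + \<bar>c\<bar> * D" for x
  proof -
    have "\<bar>c * g x\<bar> \<le> \<bar>c\<bar> * D" unfolding abs_mult by (intro mult_left_mono g(2)) simp
    then show ?thesis using f(2)[of x] unfolding h_def by linarith
  qed
  have "sets \<nu> = sets borel" using \<nu> by (auto simp: invariant_probs_def borel_probs_def)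
  then have meas: "u \<in> borel_measurable \<nu>" if "u \<in> borel_measurable borel" for u :: "'a \<Rightarrow> real"
    using that measurable_cong_sets by blast
  note [measurable] = meas[OF f(1)] meas[OF g(1)] meas[OF h]
  have [measurable]: "(\<lambda>x. avg h S x n) \<in> borel_measurable \<nu>" for n
    unfolding avg_eq_orbit_sums by measurable
  note conv_f = AE_convergent_avg[OF \<nu> S f] and conv_g = AE_convergent_avg[OF \<nu> S g]
    and conv_h = AE_convergent_avg[OF \<nu> S h h_bound]
  define l where "l x = lim (avg h S x)" for x
  have l_meas [measurable]: "l \<in> borel_measurable \<nu>"
    unfolding l_def by (rule borel_measurable_lim_metric) measurable
  have lim_l: "AE x in \<nu>. (\<lambda>n. avg h S x n) \<longlonglongrightarrow> l x"
    using conv_h by eventually_elim (simp add: l_def convergent_LIMSEQ_iff)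
  have bound: "AE x in \<nu>. norm (avg h S x n) \<le> B + \<bar>c\<bar> * D" for n
    using abs_avg_le[of h, OF h_bound] by (intro AE_I2) simp
  have l_int: "integrable \<nu> l" and "(\<lambda>n. \<integral>x. avg h S x n \<partial>\<nu>) \<longlonglongrightarrow> (\<integral>x. l x \<partial>\<nu>)"
    by (rule integrable_dominated_convergence[OF _ _ _ lim_l bound], simp_all)
      (rule integral_dominated_convergence[OF _ _ _ lim_l bound], simp_all)
  then have "(\<integral>x. l x \<partial>\<nu>) = (\<integral>x. h x \<partial>\<nu>)"
    unfolding integral_avg[OF \<nu> S meas[OF h] h_bound] by (simp add: LIMSEQ_const_iff)
  also have "\<dots> = (\<integral>x. f x \<partial>\<nu>) + c * (\<integral>x. g x \<partial>\<nu>)"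
  proof -
    have "integrable \<nu> f" "integrable \<nu> g"
      using f(2) g(2) by (auto intro!: F.integrable_const_bound[of f B] F.integrable_const_bound[of g D])
    then show ?thesis unfolding h_def by simp
  qed
  finally have int_l: "(\<integral>x. l x \<partial>\<nu>) = (\<integral>x. f x \<partial>\<nu>) + c * (\<integral>x. g x \<partial>\<nu>)" .
  have "\<exists>q. convergent (avg f S q) \<and> convergent (avg g S q) \<and> (\<integral>x. l x \<partial>\<nu>) \<le> l q"
  proof (rule ccontr)
    assume "\<not> ?thesis"
    then have *: "l x < (\<integral>x. l x \<partial>\<nu>)" if "convergent (avg f S x)" "convergent (avg g S x)" for x
      using that by (metis not_le)
    have "AE x in \<nu>. l x < (\<integral>x. l x \<partial>\<nu>)"
      using conv_f conv_g by eventually_elim (rule *)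
    then have "(\<integral>x. l x \<partial>\<nu>) < (\<integral>x. l x \<partial>\<nu>)"
      by (rule F.expectation_less[OF l_int])
    then show False by simp
  qed
  then obtain q a b where q: "avg f S q \<longlonglongrightarrow> a" "avg g S q \<longlonglongrightarrow> b" "(\<integral>x. l x \<partial>\<nu>) \<le> l q"
    by (auto simp: convergent_def)
  have "avg h S q = (\<lambda>n. avg f S q n + c * avg g S q n)"
    unfolding h_def by (intro ext) (simp add: avg_add avg_scale)
  then have "avg h S q \<longlonglongrightarrow> a + c * b"
    using q(1,2) by (auto intro!: tendsto_intros)
  then have "l q = a + c * b" unfolding l_def by (rule limI)
  then show thesis using that q int_l by simp
qed

text \<open>
  Take a point where \<open>a + C * b\<close> is at least its mean, \<open>a\<close> and \<open>b\<close> being the limiting averages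
  of \<open>\<psi>\<close> and of the bump function at \<open>F\<close>.  Then \<open>b \<le> 1\<close> bounds \<open>a\<close> below at a loss of \<open>C * t\<close>, and
  \<open>a \<le> M\<close> with \<open>- M \<le> \<integral>\<psi> d\<nu>\<close> bounds \<open>b\<close> below at a loss of \<open>t + 2 * M / C\<close>.  The weight \<open>C = 4 * M / \<epsilon>\<close> makes
  \<open>2 * M / C\<close> equal to \<open>\<epsilon> / 2\<close>, and the two upper bounds on \<open>t\<close> absorb the rest.
\<close>
lemma exists_point_near_set_above_mean:
  fixes S :: "'a::metric_space \<Rightarrow> 'a"
  assumes \<nu>: "\<nu> \<in> invariant_probs S"
    and S: "bij S" "continuous_on UNIV S" "continuous_on UNIV (inv S)"
    and \<psi>: "continuous_on UNIV \<psi>" "\<And>x. \<bar>\<psi> x\<bar> \<le> M" "0 < M"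
    and \<epsilon>: "0 < \<epsilon>" and \<sigma>: "0 < \<sigma>" and F: "F \<noteq> {}"
    and t: "1 - t \<le> (\<integral>x. bump (1 / \<sigma>) F x \<partial>\<nu>)" "t \<le> \<epsilon> / 2" "4 * M * t \<le> \<epsilon>\<^sup>2 / 2"
  obtains q a where "avg \<psi> S q \<longlonglongrightarrow> a" "(\<integral>x. \<psi> x \<partial>\<nu>) - \<epsilon> / 2 \<le> a"
    "ereal (1 - \<epsilon>) \<le> liminf (\<lambda>n. ereal (visit_freq (nhd \<sigma> F) S q n))"
proof -
  interpret prob_space \<nu> using \<nu> by (simp add: invariant_probs_def borel_probs_def)
  define f where "f = bump (1 / \<sigma>) F"
  define C where "C = 4 * M / \<epsilon>"
  have C: "0 < C" using \<psi>(3) \<epsilon> by (simp add: C_def)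
  have f_le: "f x \<le> 1" and f_nonneg: "0 \<le> f x" for x
    using \<sigma> by (simp_all add: f_def bump_le_1 bump_nonneg)
  have f: "f \<in> borel_measurable borel" "\<And>x. \<bar>f x\<bar> \<le> 1"
    unfolding f_def[symmetric]
    by (simp add: f_def borel_measurable_continuous_onI continuous_on_bump) (simp add: f_le f_nonneg)
  obtain q a b where q: "avg \<psi> S q \<longlonglongrightarrow> a" "avg f S q \<longlonglongrightarrow> b"
    and ab: "(\<integral>x. \<psi> x \<partial>\<nu>) + C * (\<integral>x. f x \<partial>\<nu>) \<le> a + C * b"
    using exists_point_above_mean[OF \<nu> S borel_measurable_continuous_onI[OF \<psi>(1)] \<psi>(2) f] .
  have "avg f S q n \<le> 1" for n
    using avg_mono[of f S q "\<lambda>_. 1" n] f_le by (simp add: avg_const)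
  then have b_le: "b \<le> 1" by (intro LIMSEQ_le_const2[OF q(2)]) auto
  have a_le: "a \<le> M"
    using abs_avg_le[of \<psi>, OF \<psi>(2)] by (intro LIMSEQ_le_const2[OF q(1)]) (auto simp: abs_le_iff)
  have int_ge: "- M \<le> (\<integral>x. \<psi> x \<partial>\<nu>)"
  proof -
    have "\<psi> \<in> borel_measurable borel" using \<psi>(1) by (rule borel_measurable_continuous_onI)
    moreover have "sets \<nu> = sets borel" using \<nu> by (simp add: invariant_probs_def borel_probs_def)
    ultimately have "\<psi> \<in> borel_measurable \<nu>" using measurable_cong_sets by blast
    then have "integrable \<nu> \<psi>" using \<psi>(2) by (intro integrable_const_bound[of _ M]) auto
    moreover have "- M \<le> \<psi> x" for x using \<psi>(2)[of x] by (simp add: abs_le_iff minus_le_iff)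
    ultimately show ?thesis by (intro integral_ge_const) auto
  qed
  have Ct: "C * t \<le> \<epsilon> / 2"
  proof -
    have "C * t = 4 * M * t / \<epsilon>" by (simp add: C_def)
    also have "\<dots> \<le> (\<epsilon>\<^sup>2 / 2) / \<epsilon>" using t(3) \<epsilon> by (intro divide_right_mono) auto
    also have "\<dots> = \<epsilon> / 2" using \<epsilon> by (simp add: power2_eq_square)
    finally show ?thesis .
  qed
  have low: "(\<integral>x. \<psi> x \<partial>\<nu>) + (C - C * t) \<le> a + C * b"
  proof -
    have "C * (1 - t) \<le> C * (\<integral>x. f x \<partial>\<nu>)" using t(1) C unfolding f_def by (intro mult_left_mono) auto
    then show ?thesis using ab by (simp add: algebra_simps)
  qed
  have "C * b \<le> C" using b_le C by simp
  then have a_ge: "(\<integral>x. \<psi> x \<partial>\<nu>) - \<epsilon> / 2 \<le> a" using low Ct by linarith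
  have "C * (1 - \<epsilon>) \<le> C * b"
  proof -
    have "C * t \<le> C * (\<epsilon> / 2)" using t(2) C by (intro mult_left_mono) auto
    moreover have "C * \<epsilon> = 4 * M" using \<epsilon> by (simp add: C_def)
    ultimately show ?thesis using low int_ge a_le by (simp add: algebra_simps)
  qed
  then have b_ge: "1 - \<epsilon> \<le> b" using C by simp
  have "avg f S q n \<le> visit_freq (nhd \<sigma> F) S q n" for n
  proof -
    let ?J = "{- int n..int n}"
    have f_ind: "f x \<le> indicator (nhd \<sigma> F) x" for x
    proof (cases "infdist x F < \<sigma>")
      case True
      then obtain y where "y \<in> F" "dist x y < \<sigma>"
        using F by (metis cINF_greatest infdist_notempty not_le)
      then have "x \<in> nhd \<sigma> F" by (auto simp: nhd_def dist_commute)
      then show ?thesis using f_le by simp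
    next
      case False
      then have "f x = 0" using \<sigma> by (simp add: f_def bump_def)
      then show ?thesis by simp
    qed
    have "(\<Sum>k\<in>?J. f (ziter S k q)) \<le> (\<Sum>k\<in>?J. indicator (nhd \<sigma> F) (ziter S k q))"
      by (intro sum_mono f_ind)
    also have "\<dots> = real (card {k \<in> ?J. ziter S k q \<in> nhd \<sigma> F})"
      by (simp add: indicator_def sum.If_cases Int_def)
    finally show ?thesis unfolding avg_def visit_freq_def by (intro divide_right_mono) auto
  qed
  then have "liminf (\<lambda>n. ereal (avg f S q n)) \<le> liminf (\<lambda>n. ereal (visit_freq (nhd \<sigma> F) S q n))"
    by (intro Liminf_mono always_eventually) simp
  moreover have "liminf (\<lambda>n. ereal (avg f S q n)) = ereal b"
    using q(2) by (intro lim_imp_Liminf) auto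
  ultimately have "ereal (1 - \<epsilon>) \<le> liminf (\<lambda>n. ereal (visit_freq (nhd \<sigma> F) S q n))"
    using b_ge by (metis ereal_less_eq(3) order.trans)
  then show thesis using that q(1) a_ge by blast
qed

section \<open>Consequences of closeness in the Kantorovich-Rubinstein and Hausdorff distances\<close>

lemma lipschitz_integral_diff_le:
  assumes K: "compact (UNIV :: 'a::metric_space set)"
  obtains D where "\<And>\<mu> \<nu> (f :: 'a \<Rightarrow> real). \<mu> \<in> borel_probs \<Longrightarrow> \<nu> \<in> borel_probs \<Longrightarrow> 1-lipschitz_on UNIV f \<Longrightarrow>
    (\<integral>x. f x \<partial>\<mu>) - (\<integral>x. f x \<partial>\<nu>) \<le> D"
proof -
  obtain D where D: "\<And>x y :: 'a. dist x y \<le> D"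
    using compact_imp_bounded[OF K] by (auto simp: bounded_two_points)
  have near: "\<bar>(\<integral>x. f x \<partial>\<mu>) - f y\<bar> \<le> D"
    if \<mu>: "\<mu> \<in> borel_probs" and f: "1-lipschitz_on UNIV f" for \<mu> and f :: "'a \<Rightarrow> real" and y
  proof -
    interpret prob_space \<mu> using \<mu> by (simp add: borel_probs_def)
    have "\<bar>f x - f y\<bar> \<le> D" for x
      using lipschitz_onD[OF f, of x y] D[of x y] by (simp add: dist_real_def)
    then have bd: "f x \<le> f y + D" "f y - D \<le> f x" for x by (smt (verit))+
    have "f \<in> borel_measurable borel"
      by (intro borel_measurable_continuous_onI lipschitz_on_continuous_on[OF f])
    moreover have "sets \<mu> = sets borel" using \<mu> by (simp add: borel_probs_def)
    ultimately have "f \<in> borel_measurable \<mu>" using measurable_cong_sets by blast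
    moreover have "\<bar>f x\<bar> \<le> \<bar>f y\<bar> + D" for x using bd[of x] by linarith
    ultimately have "integrable \<mu> f" by (intro integrable_const_bound[of _ "\<bar>f y\<bar> + D"]) auto
    then have "(\<integral>x. f x \<partial>\<mu>) \<le> f y + D" "f y - D \<le> (\<integral>x. f x \<partial>\<mu>)"
      using bd by (intro integral_le_const integral_ge_const; auto)+
    then show ?thesis by linarith
  qed
  have "(\<integral>x. f x \<partial>\<mu>) - (\<integral>x. f x \<partial>\<nu>) \<le> D + D"
    if "\<mu> \<in> borel_probs" "\<nu> \<in> borel_probs" "1-lipschitz_on UNIV f" for \<mu> \<nu> and f :: "'a \<Rightarrow> real"
    using near[OF that(1,3), of undefined] near[OF that(2,3), of undefined] by linarith
  then show thesis using that by blast
qed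

text \<open>
  The suprema and infima that define \<open>W1\<close> and \<open>dH\<close> are taken over the reals, where they carry information
  only for bounded families; these bounds make them meaningful.
\<close>
lemma W1_bounds:
  assumes K: "compact (UNIV :: 'a::metric_space set)"
  obtains D where "\<And>\<mu> \<nu> :: 'a measure. \<mu> \<in> borel_probs \<Longrightarrow> \<nu> \<in> borel_probs \<Longrightarrow> 0 \<le> W1 \<mu> \<nu> \<and> W1 \<mu> \<nu> \<le> D"
    and "\<And>\<mu> \<nu> f. \<mu> \<in> borel_probs \<Longrightarrow> \<nu> \<in> borel_probs \<Longrightarrow> 1-lipschitz_on UNIV (f :: 'a \<Rightarrow> real) \<Longrightarrow>
      (\<integral>x. f x \<partial>\<mu>) - (\<integral>x. f x \<partial>\<nu>) \<le> W1 \<mu> \<nu>"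
proof -
  obtain D where D: "\<And>\<mu> \<nu> (f :: 'a \<Rightarrow> real). \<mu> \<in> borel_probs \<Longrightarrow> \<nu> \<in> borel_probs \<Longrightarrow>
      1-lipschitz_on UNIV f \<Longrightarrow> (\<integral>x. f x \<partial>\<mu>) - (\<integral>x. f x \<partial>\<nu>) \<le> D"
    using lipschitz_integral_diff_le[OF K] by blast
  have zero: "1-lipschitz_on UNIV (\<lambda>_ :: 'a. 0 :: real)" by (simp add: lipschitz_on_def)
  have upper: "(\<integral>x. f x \<partial>\<mu>) - (\<integral>x. f x \<partial>\<nu>) \<le> W1 \<mu> \<nu>"
    if "\<mu> \<in> borel_probs" "\<nu> \<in> borel_probs" "1-lipschitz_on UNIV f" for \<mu> \<nu> and f :: "'a \<Rightarrow> real"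
    unfolding W1_def using D[OF that(1,2)] that(3)
    by (intro cSUP_upper) (auto simp: bdd_above_def)
  have "0 \<le> W1 \<mu> \<nu>" if "\<mu> \<in> borel_probs" "\<nu> \<in> borel_probs" for \<mu> \<nu> :: "'a measure"
    using upper[OF that zero] by simp
  moreover have "W1 \<mu> \<nu> \<le> D" if "\<mu> \<in> borel_probs" "\<nu> \<in> borel_probs" for \<mu> \<nu> :: "'a measure"
    unfolding W1_def using D[OF that] zero by (intro cSUP_least) auto
  ultimately show thesis using that upper by blast
qed

lemma dH_less_obtain:
  fixes P Q :: "'a::metric_space measure set"
  assumes K: "compact (UNIV :: 'a set)"
    and P: "P \<subseteq> borel_probs" "P \<noteq> {}" and Q: "Q \<subseteq> borel_probs" and dH: "dH P Q < e" and \<mu>: "\<mu> \<in> Q"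
  obtains \<nu> where "\<nu> \<in> P" "W1 \<mu> \<nu> < e"
proof -
  obtain D where D: "\<And>\<mu> \<nu> :: 'a measure. \<mu> \<in> borel_probs \<Longrightarrow> \<nu> \<in> borel_probs \<Longrightarrow> 0 \<le> W1 \<mu> \<nu> \<and> W1 \<mu> \<nu> \<le> D"
    using W1_bounds[OF K] by metis
  have inf: "0 \<le> (INF \<nu>\<in>B. W1 \<mu> \<nu>)" "(INF \<nu>\<in>B. W1 \<mu> \<nu>) \<le> D"
    if AB: "\<mu> \<in> A" "A \<subseteq> borel_probs" "B \<subseteq> borel_probs" "B \<noteq> {}" for A B and \<mu> :: "'a measure"
  proof -
    show "0 \<le> (INF \<nu>\<in>B. W1 \<mu> \<nu>)" using D AB by (intro cINF_greatest) auto
    obtain \<nu> where "\<nu> \<in> B" using AB(4) by blast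
    then show "(INF \<nu>\<in>B. W1 \<mu> \<nu>) \<le> D"
      using D AB by (intro cINF_lower2[of _ _ \<nu>] bdd_belowI2[of _ 0]) auto
  qed
  have Q_ne: "Q \<noteq> {}" using \<mu> by blast
  obtain \<pi> where \<pi>: "\<pi> \<in> P" using P by blast
  have "0 \<le> (INF \<nu>\<in>Q. W1 \<pi> \<nu>)" by (rule inf(1)[OF \<pi> P(1) Q Q_ne])
  also have "\<dots> \<le> (SUP \<mu>\<in>P. INF \<nu>\<in>Q. W1 \<mu> \<nu>)"
    using inf(2)[OF _ P(1) Q Q_ne] by (intro cSUP_upper \<pi>) (auto simp: bdd_above_def)
  finally have first: "0 \<le> (SUP \<mu>\<in>P. INF \<nu>\<in>Q. W1 \<mu> \<nu>)" .
  have "(INF \<nu>\<in>P. W1 \<mu> \<nu>) \<le> (SUP \<mu>\<in>Q. INF \<nu>\<in>P. W1 \<mu> \<nu>)"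
    using inf(2)[OF _ Q P] by (intro cSUP_upper \<mu>) (auto simp: bdd_above_def)
  then have "(INF \<nu>\<in>P. W1 \<mu> \<nu>) < e" using first dH by (simp add: dH_def)
  moreover have "bdd_below (W1 \<mu> ` P)" using P(1) D \<mu> Q by (intro bdd_belowI2[of _ 0]) auto
  ultimately obtain \<nu> where "\<nu> \<in> P" "W1 \<mu> \<nu> < e"
    using P(2) by (auto simp: cINF_less_iff)
  then show thesis using that by blast
qed

lemma lipschitz_integral_le_W1:
  assumes K: "compact (UNIV :: 'a::metric_space set)"
    and \<mu>\<nu>: "\<mu> \<in> borel_probs" "\<nu> \<in> borel_probs"
    and f: "L-lipschitz_on UNIV (f :: 'a \<Rightarrow> real)" and L: "0 < L"
  shows "\<bar>(\<integral>x. f x \<partial>\<mu>) - (\<integral>x. f x \<partial>\<nu>)\<bar> \<le> L * W1 \<mu> \<nu>"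
proof -
  have W1: "(\<integral>x. g x \<partial>\<mu>) - (\<integral>x. g x \<partial>\<nu>) \<le> W1 \<mu> \<nu>" if "1-lipschitz_on UNIV g" for g :: "'a \<Rightarrow> real"
    using W1_bounds[OF K] \<mu>\<nu> that by metis
  have "(\<bar>c\<bar> * L)-lipschitz_on UNIV (\<lambda>x. c * f x)" for c
    by (rule lipschitz_on_cmult_real[OF f])
  from W1[of "\<lambda>x. (1 / L) * f x"] W1[of "\<lambda>x. (- 1 / L) * f x"] this[of "1 / L"] this[of "- 1 / L"]
  have "(1 / L) * (\<integral>x. f x \<partial>\<mu>) - (1 / L) * (\<integral>x. f x \<partial>\<nu>) \<le> W1 \<mu> \<nu>"
    "(- 1 / L) * (\<integral>x. f x \<partial>\<mu>) - (- 1 / L) * (\<integral>x. f x \<partial>\<nu>) \<le> W1 \<mu> \<nu>"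
    using L by (simp_all only: integral_mult_right_zero) auto
  then show ?thesis using L by (auto simp: field_simps abs_le_iff)
qed

lemma lipschitz_on_bump:
  assumes "0 \<le> c"
  shows "c-lipschitz_on S (bump c F)"
proof (rule lipschitz_onI[OF _ assms])
  fix x y
  have "\<bar>bump c F x - bump c F y\<bar> \<le> \<bar>c * infdist x F - c * infdist y F\<bar>"
    unfolding bump_def by linarith
  also have "\<dots> = c * \<bar>infdist x F - infdist y F\<bar>"
    using assms by (simp add: abs_mult right_diff_distrib[symmetric])
  also have "\<dots> \<le> c * dist x y"
    using assms by (intro mult_left_mono infdist_triangle_abs)
  finally show "dist (bump c F x) (bump c F y) \<le> c * dist x y" by (simp add: dist_real_def)
qed

text \<open>
  The infimal convolution of \<open>\<phi>\<close> with \<open>L * dist\<close> is \<open>L\<close>-Lipschitz and lies below \<open>\<phi>\<close>.  Near \<open>x\<close> the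
  infimand exceeds \<open>\<phi> x - e\<close> by uniform continuity, far from \<open>x\<close> because the slope \<open>L\<close> outweighs the
  oscillation of \<open>\<phi>\<close>.
\<close>
lemma lipschitz_approximation:
  fixes \<phi> :: "'a::metric_space \<Rightarrow> real"
  assumes K: "compact (UNIV :: 'a set)" and \<phi>: "continuous_on UNIV \<phi>" and e: "0 < e"
  obtains L g where "0 < L" "L-lipschitz_on UNIV g" "\<And>x. \<bar>\<phi> x - g x\<bar> \<le> e"
proof -
  obtain B where B: "\<And>x. \<bar>\<phi> x\<bar> \<le> B"
    using compact_imp_bounded[OF compact_continuous_image[OF \<phi> K]] by (auto simp: bounded_iff)
  obtain d where d: "0 < d" "\<And>x y. dist x y < d \<Longrightarrow> dist (\<phi> x) (\<phi> y) < e"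
    using compact_uniformly_continuous[OF \<phi> K] e unfolding uniformly_continuous_on_def by auto
  define L where "L = (2 * \<bar>B\<bar> + 1) / d"
  have L: "0 < L" using d(1) by (simp add: L_def)
  define g where "g x = (INF y. \<phi> y + L * dist x y)" for x
  have bdd: "bdd_below (range (\<lambda>y. \<phi> y + L * dist x y))" for x
  proof (rule bdd_belowI2)
    fix y
    have "0 \<le> L * dist x y" using L by simp
    then show "- B \<le> \<phi> y + L * dist x y" using B[of y] by linarith
  qed
  have g_le: "g x \<le> \<phi> x" for x
    using cINF_lower[OF bdd UNIV_I, of x x] by (simp add: g_def)
  have "\<phi> x - e \<le> g x" for x
    unfolding g_def
  proof (rule cINF_greatest)
    fix y
    show "\<phi> x - e \<le> \<phi> y + L * dist x y"
    proof (cases "dist x y < d")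
      case True
      then have "\<phi> x - \<phi> y < e" using d(2)[of x y] by (auto simp: dist_real_def)
      moreover have "0 \<le> L * dist x y" using L by simp
      ultimately show ?thesis by linarith
    next
      case False
      then have "L * d \<le> L * dist x y" using L by simp
      moreover have "L * d = 2 * \<bar>B\<bar> + 1" using d(1) by (simp add: L_def)
      ultimately show ?thesis using B[of x] B[of y] e by linarith
    qed
  qed simp
  then have "\<bar>\<phi> x - g x\<bar> \<le> e" for x using g_le[of x] by (simp add: abs_le_iff algebra_simps)
  moreover have "L-lipschitz_on UNIV g"
  proof (rule lipschitz_onI)
    have half: "g x - L * dist x y \<le> g y" for x y
      unfolding g_def[of y]
    proof (rule cINF_greatest)
      fix z
      have "g x \<le> \<phi> z + L * dist x z" unfolding g_def by (rule cINF_lower[OF bdd UNIV_I])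
      also have "L * dist x z \<le> L * (dist x y + dist y z)"
        using L by (intro mult_left_mono dist_triangle) simp
      finally show "g x - L * dist x y \<le> \<phi> z + L * dist y z" by (simp add: algebra_simps)
    qed simp
    show "dist (g x) (g y) \<le> L * dist x y" for x y
      using half[of x y] half[of y x] by (simp add: dist_real_def dist_commute abs_le_iff)
  qed (use L in simp)
  ultimately show thesis using that L by blast
qed

lemma integral_continuous_W1:
  fixes \<phi> :: "'a::metric_space \<Rightarrow> real"
  assumes K: "compact (UNIV :: 'a set)" and \<phi>: "continuous_on UNIV \<phi>" and e: "0 < e"
  obtains \<eta> where "0 < \<eta>"
    "\<And>\<mu> \<nu>. \<mu> \<in> borel_probs \<Longrightarrow> \<nu> \<in> borel_probs \<Longrightarrow> W1 \<mu> \<nu> < \<eta> \<Longrightarrow>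
      \<bar>(\<integral>x. \<phi> x \<partial>\<mu>) - (\<integral>x. \<phi> x \<partial>\<nu>)\<bar> \<le> e"
proof -
  obtain L g where L: "0 < L" and g: "L-lipschitz_on UNIV g" and near: "\<And>x. \<bar>\<phi> x - g x\<bar> \<le> e / 4"
    using lipschitz_approximation[OF K \<phi>, of "e / 4"] e by auto
  have int_near: "\<bar>(\<integral>x. \<phi> x \<partial>\<mu>) - (\<integral>x. g x \<partial>\<mu>)\<bar> \<le> e / 4" if \<mu>: "\<mu> \<in> borel_probs" for \<mu>
  proof -
    interpret prob_space \<mu> using \<mu> by (simp add: borel_probs_def)
    have int: "integrable \<mu> f" if f: "continuous_on UNIV f" for f :: "'a \<Rightarrow> real"
    proof -
      obtain B where "\<And>x. norm (f x) \<le> B"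
        using compact_imp_bounded[OF compact_continuous_image[OF f K]] by (auto simp: bounded_iff)
      moreover have "f \<in> borel_measurable \<mu>"
        using \<mu> measurable_cong_sets[of \<mu> borel] borel_measurable_continuous_onI[OF f]
        by (auto simp: borel_probs_def)
      ultimately show ?thesis by (intro integrable_const_bound[of _ B]) auto
    qed
    have ints: "integrable \<mu> \<phi>" "integrable \<mu> g"
      by (intro int \<phi> lipschitz_on_continuous_on[OF g])+
    then have "\<bar>(\<integral>x. \<phi> x \<partial>\<mu>) - (\<integral>x. g x \<partial>\<mu>)\<bar> = \<bar>\<integral>x. \<phi> x - g x \<partial>\<mu>\<bar>" by simp
    also have "\<dots> \<le> (\<integral>x. \<bar>\<phi> x - g x\<bar> \<partial>\<mu>)" by (rule integral_abs_bound)
    also have "\<dots> \<le> e / 4"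
      using ints near by (intro integral_le_const) auto
    finally show ?thesis .
  qed
  show thesis
  proof
    show "0 < e / (2 * L)" using e L by simp
    fix \<mu> \<nu> :: "'a measure"
    assume \<mu>\<nu>: "\<mu> \<in> borel_probs" "\<nu> \<in> borel_probs" and W1: "W1 \<mu> \<nu> < e / (2 * L)"
    have "L * W1 \<mu> \<nu> \<le> e / 2" using W1 L by (simp add: field_simps)
    then show "\<bar>(\<integral>x. \<phi> x \<partial>\<mu>) - (\<integral>x. \<phi> x \<partial>\<nu>)\<bar> \<le> e"
      using lipschitz_integral_le_W1[OF K \<mu>\<nu> g L] int_near[OF \<mu>\<nu>(1)] int_near[OF \<mu>\<nu>(2)]
      by linarith
  qed
qed

section \<open>Lifting orbit averages to nearby maps\<close>

lemma diffeos_homeo: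
  assumes "S \<in> diffeos r d A"
  shows "bij S" "continuous_on UNIV S" "continuous_on UNIV (inv S)"
  using assms by (auto simp: diffeos_def Cr_map_def split: if_splits)

theorem lemma3p1:
  fixes r d :: nat
    and A :: "'a::metric_space chart set"
    and T :: "'a \<Rightarrow> 'a"
    and \<phi> :: "'a \<Rightarrow> real"
    and \<epsilon> \<sigma> :: real
  assumes "compact (UNIV :: 'a set)"
    and "r > 0 \<Longrightarrow> Cr_atlas r d A"
    and "continuity_point (diffeos r d A) T"
    and "continuous_on UNIV \<phi>"
    and "\<epsilon> > 0" and "\<sigma> > 0"
  shows "\<exists>\<delta>>0. \<forall>p. \<forall>S \<in> diffeos r d A.
    dC0 S T < \<delta> \<longrightarrow> dC0 (inv S) (inv T) < \<delta> \<longrightarrow>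
    (\<exists>qp qm.
      (\<forall>q \<in> {qp, qm}.
        liminf (\<lambda>n. ereal (visit_freq (nhd \<sigma> (closure (orbit T p))) S q n)) \<ge> ereal (1 - \<epsilon>)) \<and>
      (\<exists>L. avg \<phi> S qm \<longlonglongrightarrow> L \<and>
        ereal L \<ge> liminf (\<lambda>n. ereal (avg \<phi> T p n)) - ereal \<epsilon>) \<and>
      (\<exists>L. avg \<phi> S qp \<longlonglongrightarrow> L \<and>
        ereal L \<le> limsup (\<lambda>n. ereal (avg \<phi> T p n)) + ereal \<epsilon>))"
proof -
  note K = assms(1) and \<phi> = assms(4) and \<epsilon> = assms(5) and \<sigma> = assms(6)
  have T: "T \<in> diffeos r d A" using assms(3) by (simp add: continuity_point_def)
  obtain M where M: "0 < M" "\<And>x. \<bar>\<phi> x\<bar> \<le> M"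
    using compact_imp_bounded[OF compact_continuous_image[OF \<phi> K]] by (auto simp: bounded_pos)
  obtain \<eta>\<^sub>0 where \<eta>\<^sub>0: "0 < \<eta>\<^sub>0" "\<And>\<mu> \<nu>. \<mu> \<in> borel_probs \<Longrightarrow> \<nu> \<in> borel_probs \<Longrightarrow> W1 \<mu> \<nu> < \<eta>\<^sub>0 \<Longrightarrow>
      \<bar>(\<integral>x. \<phi> x \<partial>\<mu>) - (\<integral>x. \<phi> x \<partial>\<nu>)\<bar> \<le> \<epsilon> / 2"
    using integral_continuous_W1[OF K \<phi>, of "\<epsilon> / 2"] \<epsilon> by auto
  \<comment> \<open>The admissible loss in the integral of the bump function when passing from \<open>\<mu>\<close> to \<open>\<nu>\<close>.\<close>
  define t where "t = min (\<epsilon> / 2) (\<epsilon>\<^sup>2 / (8 * M))"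
  have t: "0 < t" "t \<le> \<epsilon> / 2" "4 * M * t \<le> \<epsilon>\<^sup>2 / 2"
  proof -
    show "0 < t" "t \<le> \<epsilon> / 2" using \<epsilon> M(1) by (simp_all add: t_def)
    have "4 * M * t \<le> 4 * M * (\<epsilon>\<^sup>2 / (8 * M))" using M(1) by (intro mult_left_mono) (auto simp: t_def)
    then show "4 * M * t \<le> \<epsilon>\<^sup>2 / 2" using M(1) by simp
  qed
  define \<eta> where "\<eta> = min \<eta>\<^sub>0 (\<sigma> * t)"
  have "0 < \<eta>" using \<eta>\<^sub>0(1) \<sigma> t(1) by (simp add: \<eta>_def)
  then obtain \<delta> where \<delta>: "0 < \<delta>"
    "\<And>S. S \<in> diffeos r d A \<Longrightarrow> dX S T < \<delta> \<Longrightarrow> dH (invariant_probs S) (invariant_probs T) < \<eta>"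
    using assms(3) unfolding continuity_point_def by blast
  have "\<exists>qp qm.
      (\<forall>q \<in> {qp, qm}.
        liminf (\<lambda>n. ereal (visit_freq (nhd \<sigma> (closure (orbit T p))) S q n)) \<ge> ereal (1 - \<epsilon>)) \<and>
      (\<exists>L. avg \<phi> S qm \<longlonglongrightarrow> L \<and>
        ereal L \<ge> liminf (\<lambda>n. ereal (avg \<phi> T p n)) - ereal \<epsilon>) \<and>
      (\<exists>L. avg \<phi> S qp \<longlonglongrightarrow> L \<and>
        ereal L \<le> limsup (\<lambda>n. ereal (avg \<phi> T p n)) + ereal \<epsilon>)"
    if S: "S \<in> diffeos r d A" and close: "dC0 S T < \<delta> / 2" "dC0 (inv S) (inv T) < \<delta> / 2" for p S
  proof -
    define F where "F = closure (orbit T p)"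
    have orbit_F: "ziter T k p \<in> F" for k
      using closure_subset[of "orbit T p"] by (auto simp: F_def orbit_def)
    then have F: "F \<noteq> {}" by blast
    note T_homeo = diffeos_homeo[OF T] and S_homeo = diffeos_homeo[OF S]
    obtain \<mu> where \<mu>: "\<mu> \<in> invariant_probs T"
      and \<mu>_ge: "\<And>f c. continuous_on UNIV f \<Longrightarrow> \<forall>\<^sub>F n in sequentially. c \<le> avg f T p n \<Longrightarrow> c \<le> (\<integral>x. f x \<partial>\<mu>)"
      using krylov_bogolyubov[OF K T_homeo(1,2)] by metis
    have S_ne: "invariant_probs S \<noteq> {}"
      using krylov_bogolyubov[OF K S_homeo(1,2)] by (metis empty_iff)
    have sub: "invariant_probs R \<subseteq> borel_probs" for R :: "'a \<Rightarrow> 'a"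
      by (auto simp: invariant_probs_def)
    have "dX S T < \<delta>" using close by (simp add: dX_def)
    then obtain \<nu> where \<nu>: "\<nu> \<in> invariant_probs S" and W1: "W1 \<mu> \<nu> < \<eta>"
      using dH_less_obtain[OF K sub S_ne sub \<delta>(2)[OF S] \<mu>] by blast
    have \<mu>\<nu>: "\<mu> \<in> borel_probs" "\<nu> \<in> borel_probs" using \<mu> \<nu> sub by auto
    have \<phi>_close: "\<bar>(\<integral>x. \<phi> x \<partial>\<mu>) - (\<integral>x. \<phi> x \<partial>\<nu>)\<bar> \<le> \<epsilon> / 2"
      using W1 by (intro \<eta>\<^sub>0(2) \<mu>\<nu>) (simp add: \<eta>_def)
    \<comment> \<open>The orbit stays in \<open>F\<close>, so the measure \<open>\<mu>\<close> gives the bump function integral at least 1.\<close>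
    have "avg (bump (1 / \<sigma>) F) T p n = 1" for n
      by (simp add: avg_def bump_eq_1[OF orbit_F] field_simps)
    then have "1 \<le> (\<integral>x. bump (1 / \<sigma>) F x \<partial>\<mu>)"
      by (intro \<mu>_ge continuous_on_bump) simp
    moreover have "\<bar>(\<integral>x. bump (1 / \<sigma>) F x \<partial>\<mu>) - (\<integral>x. bump (1 / \<sigma>) F x \<partial>\<nu>)\<bar> \<le> 1 / \<sigma> * W1 \<mu> \<nu>"
      using \<sigma> by (intro lipschitz_integral_le_W1[OF K \<mu>\<nu>] lipschitz_on_bump) auto
    moreover have "1 / \<sigma> * W1 \<mu> \<nu> \<le> t"
      using W1 \<sigma> by (simp add: \<eta>_def field_simps)
    ultimately have bump_\<nu>: "1 - t \<le> (\<integral>x. bump (1 / \<sigma>) F x \<partial>\<nu>)" by linarith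
    note point = exists_point_near_set_above_mean[OF \<nu> S_homeo _ _ M(1) \<epsilon> \<sigma> F bump_\<nu> t(2,3)]
    obtain qm a where qm: "avg \<phi> S qm \<longlonglongrightarrow> a" "(\<integral>x. \<phi> x \<partial>\<nu>) - \<epsilon> / 2 \<le> a"
      "ereal (1 - \<epsilon>) \<le> liminf (\<lambda>n. ereal (visit_freq (nhd \<sigma> F) S qm n))"
      using point[OF \<phi> M(2)] by blast
    \<comment> \<open>For \<open>- \<phi>\<close> the lower bound on the limiting average becomes the upper bound wanted for \<open>\<phi>\<close>.\<close>
    obtain qp b where qp: "avg (\<lambda>x. - \<phi> x) S qp \<longlonglongrightarrow> b" "(\<integral>x. - \<phi> x \<partial>\<nu>) - \<epsilon> / 2 \<le> b"
      "ereal (1 - \<epsilon>) \<le> liminf (\<lambda>n. ereal (visit_freq (nhd \<sigma> F) S qp n))"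
      using point[of "\<lambda>x. - \<phi> x"] \<phi> M(2) by (auto intro: continuous_on_minus)
    have neg: "avg (\<lambda>x. - \<phi> x) R x n = - avg \<phi> R x n" for R x n
      using avg_scale[of "-1" \<phi> R x n] by simp
    have "(\<lambda>n. - avg (\<lambda>x. - \<phi> x) S qp n) \<longlonglongrightarrow> - b" by (rule tendsto_minus[OF qp(1)])
    then have qp_lim: "avg \<phi> S qp \<longlonglongrightarrow> - b" by (simp add: neg)
    have lower: "liminf (\<lambda>n. ereal (avg \<phi> T p n)) \<le> ereal (\<integral>x. \<phi> x \<partial>\<mu>)"
    proof (rule ccontr)
      assume "\<not> ?thesis"
      then obtain c where c: "ereal (\<integral>x. \<phi> x \<partial>\<mu>) < ereal c" "ereal c < liminf (\<lambda>n. ereal (avg \<phi> T p n))"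
        using ereal_dense2 by (metis not_le)
      have "\<forall>\<^sub>F n in sequentially. c \<le> avg \<phi> T p n"
        using less_LiminfD[OF c(2)] by (auto elim: eventually_mono)
      then show False using \<mu>_ge[OF \<phi>] c(1) by force
    qed
    have upper: "ereal (\<integral>x. \<phi> x \<partial>\<mu>) \<le> limsup (\<lambda>n. ereal (avg \<phi> T p n))"
    proof (rule ccontr)
      assume "\<not> ?thesis"
      then obtain c where c: "limsup (\<lambda>n. ereal (avg \<phi> T p n)) < ereal c" "ereal c < ereal (\<integral>x. \<phi> x \<partial>\<mu>)"
        using ereal_dense2 by (metis not_le)
      have "\<forall>\<^sub>F n in sequentially. - c \<le> avg (\<lambda>x. - \<phi> x) T p n"
        using Limsup_lessD[OF c(1)] by (auto elim: eventually_mono simp: neg)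
      then have "- c \<le> (\<integral>x. - \<phi> x \<partial>\<mu>)" using \<phi> by (intro \<mu>_ge continuous_on_minus)
      then show False using c(2) by simp
    qed
    have "liminf (\<lambda>n. ereal (avg \<phi> T p n)) - ereal \<epsilon> \<le> ereal (\<integral>x. \<phi> x \<partial>\<mu>) - ereal \<epsilon>"
      by (intro ereal_minus_mono lower) simp
    also have "(\<integral>x. \<phi> x \<partial>\<mu>) - \<epsilon> \<le> a" using qm(2) \<phi>_close by linarith
    then have "ereal (\<integral>x. \<phi> x \<partial>\<mu>) - ereal \<epsilon> \<le> ereal a" by simp
    finally have "liminf (\<lambda>n. ereal (avg \<phi> T p n)) - ereal \<epsilon> \<le> ereal a" .
    moreover have "- b \<le> (\<integral>x. \<phi> x \<partial>\<mu>) + \<epsilon>"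
      using qp(2) \<phi>_close unfolding Bochner_Integration.integral_minus by linarith
    then have "ereal (- b) \<le> ereal (\<integral>x. \<phi> x \<partial>\<mu>) + ereal \<epsilon>" by simp
    then have "ereal (- b) \<le> limsup (\<lambda>n. ereal (avg \<phi> T p n)) + ereal \<epsilon>"
      by (rule order.trans) (intro add_right_mono upper)
    ultimately show ?thesis
      using qm(1,3) qp(3) qp_lim unfolding F_def by blast
  qed
  then show ?thesis using \<delta>(1) by (intro exI[of _ "\<delta> / 2"]) auto
qed

end
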